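(* Let $n\in\mathbb N^+$, let $k\ge 2$ be an integer with $k\le n^{0.001}$, let $\ell\le n^{0.001}$, and let $d=cn$ for a constant $c\in(0,1/2]$. Let $\mathcal F_{n,\ell}$ be the set of maps from symmetric $n\times n$ real matrices to symmetric $n\times n$ real matrices each of whose entries is a polynomial of degree at most $\ell$ in the entries of the input. Then there is a constant $C>0$ such that for all sufficiently large $n$, $$\min_{f\in\mathcal F_{n,\ell}}\ \max_{\epsilon\in[0,1]}\ \mathbb E_{(Y,\theta^\circ)\sim\mathrm{SSBM}(n,\frac dn,\epsilon,k)}\|f(Y)-\theta^\circ\|_F^2\ \ge\ C\,k\,n,$$ where $Y$ is the adjacency matrix and $\theta^\circ$ the edge connection probability matrix of the sampled model.
   Context: $\mathrm{SSBM}(n,\frac{d}{n},\epsilon,k)$ ($n$ a multiple of $k$): each vertex gets a label $x^\circ_i\in[k]$ independently and uniformly; edges are added independently with probability $(1+\frac{k-1}{k}\epsilon)\frac dn$ if $x^\circ_i=x^\circ_j$ and $(1-\frac\epsilon k)\frac dn$ otherwise. Edge connection probability matrix: $\theta^\circ_{i,j}=(1+\frac{(k-1)\epsilon}{k})\frac dn$ if $x^\circ_i=x^\circ_j$ and $(1-\frac\epsilon k)\frac dn$ otherwise. *)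

theory Defs
  imports "HOL-Analysis.Analysis"
begin

text \<open>Matrices indexed by vertices 0..n-1 are functions nat => nat => real;
 only entries with indices < n matter.\<close>

definition sym_mat :: "nat \<Rightarrow> (nat \<Rightarrow> nat \<Rightarrow> real) \<Rightarrow> bool" where
  "sym_mat n Y \<longleftrightarrow> (\<forall>i<n. \<forall>j<n. Y i j = Y j i)"

definition deg_monos :: "nat \<Rightarrow> nat \<Rightarrow> (nat \<times> nat \<Rightarrow> nat) set" where
  "deg_monos n l = {\<alpha>. (\<forall>p. \<alpha> p \<noteq> 0 \<longrightarrow> p \<in> {..<n} \<times> {..<n})
                  \<and> (\<Sum>p\<in>{..<n} \<times> {..<n}. \<alpha> p) \<le> l}"

definition monomial_eval :: "nat \<Rightarrow> (nat \<times> nat \<Rightarrow> nat) \<Rightarrow> (nat \<Rightarrow> nat \<Rightarrow> real) \<Rightarrow> real" where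
  "monomial_eval n \<alpha> Y = (\<Prod>p\<in>{..<n} \<times> {..<n}. Y (fst p) (snd p) ^ \<alpha> p)"

definition poly_maps :: "nat \<Rightarrow> nat \<Rightarrow> ((nat \<Rightarrow> nat \<Rightarrow> real) \<Rightarrow> (nat \<Rightarrow> nat \<Rightarrow> real)) set" where
  "poly_maps n l = {f.
     (\<forall>Y. sym_mat n Y \<longrightarrow> sym_mat n (f Y)) \<and>
     (\<forall>i<n. \<forall>j<n. \<exists>c :: (nat \<times> nat \<Rightarrow> nat) \<Rightarrow> real.
        \<forall>Y. sym_mat n Y \<longrightarrow> f Y i j = (\<Sum>\<alpha>\<in>deg_monos n l. c \<alpha> * monomial_eval n \<alpha> Y))}"

text \<open>Possible edges of a simple graph on {0..n-1}: pairs (i,j) with i<j<n.\<close>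
definition pairs :: "nat \<Rightarrow> (nat \<times> nat) set" where
  "pairs n = {(i,j). i < j \<and> j < n}"

definition adj :: "(nat \<times> nat) set \<Rightarrow> nat \<Rightarrow> nat \<Rightarrow> real" where
  "adj E i j = (if (i,j) \<in> E \<or> (j,i) \<in> E then 1 else 0)"

text \<open>Edge connection probability matrix theta for labels x (q = d/n).\<close>
definition ssbm_theta :: "real \<Rightarrow> real \<Rightarrow> nat \<Rightarrow> (nat \<Rightarrow> nat) \<Rightarrow> nat \<Rightarrow> nat \<Rightarrow> real" where
  "ssbm_theta q \<epsilon> k x i j =
     (if x i = x j then (1 + real (k - 1) * \<epsilon> / real k) * q else (1 - \<epsilon> / real k) * q)"

definition graph_prob :: "nat \<Rightarrow> real \<Rightarrow> real \<Rightarrow> nat \<Rightarrow> (nat \<Rightarrow> nat) \<Rightarrow> (nat \<times> nat) set \<Rightarrow> real" where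
  "graph_prob n q \<epsilon> k x E =
     (\<Prod>e\<in>pairs n. if e \<in> E then ssbm_theta q \<epsilon> k x (fst e) (snd e)
                     else 1 - ssbm_theta q \<epsilon> k x (fst e) (snd e))"

definition frob_sq :: "nat \<Rightarrow> (nat \<Rightarrow> nat \<Rightarrow> real) \<Rightarrow> real" where
  "frob_sq n A = (\<Sum>i<n. \<Sum>j<n. (A i j)\<^sup>2)"

definition ssbm_risk :: "nat \<Rightarrow> real \<Rightarrow> real \<Rightarrow> nat \<Rightarrow>
      ((nat \<Rightarrow> nat \<Rightarrow> real) \<Rightarrow> (nat \<Rightarrow> nat \<Rightarrow> real)) \<Rightarrow> real" where
  "ssbm_risk n q \<epsilon> k f =
     (\<Sum>x\<in>PiE {..<n} (\<lambda>_. {..<k}). (1 / real k ^ n) *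
        (\<Sum>E\<in>Pow (pairs n). graph_prob n q \<epsilon> k x E *
           frob_sq n (\<lambda>i j. f (adj E) i j - ssbm_theta q \<epsilon> k x i j)))"

end

theory Submission
  imports Defs "HOL-Real_Asymp.Real_Asymp"
begin

text \<open>
  Write \<open>M\<^sub>e = 1[x\<^sub>i = x\<^sub>j] - 1/k\<close> for \<open>e = (i, j)\<close>, so that \<open>\<theta>\<^sub>e = q (1 + \<epsilon> M\<^sub>e)\<close>, and take \<open>\<epsilon>\<close> a small
  constant multiple of \<open>k / sqrt (c n)\<close>, just below the Kesten--Stigum threshold. For a fixed pair
  \<open>(u, v)\<close> define \<open>\<kappa>\<close> on edge sets by \<open>\<Sum>T\<subseteq>S. \<kappa>\<^sub>T E[M\<^sup>S\<^sup>-\<^sup>T] = E[M\<^sub>u\<^sub>v M\<^sup>S]\<close> (the cumulants of Schramm and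
  Wein). The function \<open>h = \<Sum>T. (q\<epsilon>)\<^sup>|\<^sup>T\<^sup>| \<kappa>\<^sub>T \<Prod>e\<in>T. (Y\<^sub>e - \<theta>\<^sub>e) / (\<theta>\<^sub>e (1 - \<theta>\<^sub>e))\<close>, with \<open>T\<close> ranging over the edge
  sets of size at most \<open>\<ell>\<close>, has the same correlation as \<open>M\<^sub>u\<^sub>v\<close> with every polynomial of degree at
  most \<open>\<ell>\<close> in \<open>Y\<close>; hence no such polynomial estimates \<open>M\<^sub>u\<^sub>v\<close> with error below \<open>E M\<^sub>u\<^sub>v\<^sup>2 - E h\<^sup>2\<close>.

  It remains to see that \<open>E h\<^sup>2\<close> is much smaller than \<open>1/k\<close>. The cumulant \<open>\<kappa>\<^sub>S\<close> vanishes unless \<open>S\<close>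
  together with the edge \<open>uv\<close> is connected and every vertex other than \<open>u, v\<close> has degree at least two.
  Such an \<open>S\<close> with \<open>p\<close> vertices besides \<open>u, v\<close> and \<open>p + j\<close> edges has \<open>O(j)\<close> edges at branching vertices,
  which gives \<open>|\<kappa>\<^sub>S| \<le> (2/k)\<^sup>p\<^sup>+\<^sup>1 (4\<ell>+4)\<^sup>6\<^sup>j\<close>, and there are at most \<open>2 (2n)\<^sup>p (2(\<ell>+2)\<^sup>2)\<^sup>j\<close> of them. The
  sum over \<open>p\<close> is geometric by the choice of \<open>\<epsilon>\<close>, and every one of the \<open>j \<ge> 1\<close> closing edges gains
  a factor close to \<open>1/n\<close>.
\<close>

section \<open>Averages over labellings\<close>

definition avg :: "nat \<Rightarrow> nat \<Rightarrow> ((nat \<Rightarrow> nat) \<Rightarrow> real) \<Rightarrow> real" where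
  "avg n k g = (\<Sum>x\<in>PiE {..<n} (\<lambda>_. {..<k}). g x) / real k ^ n"

text \<open>The quantifiers range over all functions, not only over labellings in the
  \<open>PiE\<close>, so overwriting a label raises no range conditions.\<close>

definition depends_on :: "nat set \<Rightarrow> ((nat \<Rightarrow> nat) \<Rightarrow> real) \<Rightarrow> bool" where
  "depends_on W g \<longleftrightarrow> (\<forall>x y. (\<forall>i\<in>W. x i = y i) \<longrightarrow> g x = g y)"

text \<open>This is the conditional expectation given every label except that of \<open>w\<close>.
  All averages below are computed by resampling one vertex at a time.\<close>

definition resample :: "nat \<Rightarrow> nat \<Rightarrow> ((nat \<Rightarrow> nat) \<Rightarrow> real) \<Rightarrow> (nat \<Rightarrow> nat) \<Rightarrow> real" where
  "resample k w g x = (\<Sum>b<k. g (x(w := b))) / real k"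

lemma avg_const: "k > 0 \<Longrightarrow> avg n k (\<lambda>_. a) = a"
  by (simp add: avg_def card_PiE)

lemma avg_cmult: "avg n k (\<lambda>x. a * g x) = a * avg n k g"
  by (simp add: avg_def sum_distrib_left)

lemma avg_cmult_right: "avg n k (\<lambda>x. g x * a) = avg n k g * a"
  by (simp add: avg_def sum_distrib_right)

lemma avg_add: "avg n k (\<lambda>x. g x + h x) = avg n k g + avg n k h"
  by (simp add: avg_def sum.distrib add_divide_distrib)

lemma avg_diff: "avg n k (\<lambda>x. g x - h x) = avg n k g - avg n k h"
  by (simp add: avg_def sum_subtractf diff_divide_distrib)

lemma avg_sum: "avg n k (\<lambda>x. \<Sum>i\<in>I. g i x) = (\<Sum>i\<in>I. avg n k (g i))"
  unfolding avg_def by (subst sum.swap) (simp add: sum_divide_distrib)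

lemma avg_cong:
  "(\<And>x. x \<in> PiE {..<n} (\<lambda>_. {..<k}) \<Longrightarrow> g x = h x) \<Longrightarrow> avg n k g = avg n k h"
  by (simp add: avg_def)

lemma avg_mono:
  "(\<And>x. x \<in> PiE {..<n} (\<lambda>_. {..<k}) \<Longrightarrow> g x \<le> h x) \<Longrightarrow> avg n k g \<le> avg n k h"
  unfolding avg_def by (intro divide_right_mono sum_mono) auto

lemma abs_avg_le: "\<bar>avg n k g\<bar> \<le> avg n k (\<lambda>x. \<bar>g x\<bar>)"
  by (simp add: avg_def divide_right_mono)

text \<open>Exchanging the label of \<open>w\<close> with the fresh label \<open>b\<close> is an
  involution on pairs (labelling, label). It turns the resampled double sum into \<open>k\<close>
  copies of the original sum.\<close>

lemma avg_resample:
  assumes "w < n" "k > 0"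
  shows "avg n k (resample k w g) = avg n k g"
proof -
  let ?X = "PiE {..<n} (\<lambda>_. {..<k})"
  define swap where "swap = (\<lambda>p :: (nat \<Rightarrow> nat) \<times> nat. ((fst p)(w := snd p), fst p w))"
  have swap_swap: "swap (swap p) = p" for p
    by (simp add: swap_def)
  have swap_in: "swap p \<in> ?X \<times> {..<k}" if "p \<in> ?X \<times> {..<k}" for p
  proof -
    have "(fst p)(w := snd p) \<in> PiE (insert w {..<n}) (\<lambda>_. {..<k})"
      using that by (intro PiE_fun_upd) (simp_all add: mem_Times_iff)
    moreover have "insert w {..<n} = {..<n}" using assms by auto
    moreover have "fst p w \<in> {..<k}"
      using that assms(1) PiE_mem[of "fst p" "{..<n}" "\<lambda>_. {..<k}" w] by (simp add: mem_Times_iff)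
    ultimately show ?thesis by (simp add: swap_def)
  qed
  have "(\<Sum>x\<in>?X. \<Sum>b<k. g (x(w := b))) = (\<Sum>p\<in>?X \<times> {..<k}. g (fst (swap p)))"
    unfolding swap_def by (simp only: sum.cartesian_product case_prod_unfold fst_conv)
  also have "\<dots> = (\<Sum>p\<in>?X \<times> {..<k}. g (fst p))"
    by (rule sum.reindex_bij_witness[where i = swap and j = swap]) (rule swap_swap swap_in refl, assumption?)+
  also have "\<dots> = (\<Sum>x\<in>?X. \<Sum>b<k. g x)"
    by (simp only: sum.cartesian_product case_prod_unfold)
  also have "\<dots> = real k * (\<Sum>x\<in>?X. g x)"
    by (simp add: sum_distrib_left)
  finally have "(\<Sum>x\<in>?X. \<Sum>b<k. g (x(w := b))) / real k = (\<Sum>x\<in>?X. g x)"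
    using assms(2) by simp
  then show ?thesis
    unfolding avg_def resample_def sum_divide_distrib[symmetric] by simp
qed

lemma resample_mult:
  assumes "depends_on (- {w}) g"
  shows "resample k w (\<lambda>x. g x * h x) x = g x * resample k w h x"
proof -
  have "g (x(w := b)) = g x" for b
    using assms unfolding depends_on_def by (elim allE[of _ "x(w := b)"] allE[of _ x]) auto
  then show ?thesis
    by (simp add: resample_def sum_distrib_left)
qed

lemma depends_on_mono: "depends_on U g \<Longrightarrow> U \<subseteq> W \<Longrightarrow> depends_on W g"
  unfolding depends_on_def by blast

lemma depends_on_const: "depends_on U (\<lambda>_. a)"
  by (simp add: depends_on_def)

lemma depends_on_mult:
  "depends_on U g \<Longrightarrow> depends_on U h \<Longrightarrow> depends_on U (\<lambda>x. g x * h x)"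
  unfolding depends_on_def by (intro allI impI arg_cong2[where f = "(*)"]) auto

lemma depends_on_abs: "depends_on U g \<Longrightarrow> depends_on U (\<lambda>x. \<bar>g x\<bar>)"
  unfolding depends_on_def by (intro allI impI arg_cong[where f = abs]) auto

lemma depends_on_resample:
  assumes "depends_on (insert w W) h"
  shows "depends_on W (resample k w h)"
  unfolding depends_on_def
proof (intro allI impI)
  fix x y :: "nat \<Rightarrow> nat"
  assume *: "\<forall>i\<in>W. x i = y i"
  have "h (x(w := b)) = h (y(w := b))" for b
    using assms * unfolding depends_on_def
    by (elim allE[of _ "x(w := b)"] allE[of _ "y(w := b)"]) auto
  then show "resample k w h x = resample k w h y"
    by (simp add: resample_def)
qed

text \<open>Resampling a vertex of \<open>W\<close> leaves \<open>g\<close> untouched and removes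
  that vertex from the dependence of \<open>h\<close>. Once \<open>W\<close> is exhausted,
  \<open>h\<close> is constant and factors out.\<close>

lemma avg_indep:
  assumes "finite W" "W \<subseteq> {..<n}" "k > 0" "depends_on W h" "depends_on (- W) g"
  shows "avg n k (\<lambda>x. g x * h x) = avg n k g * avg n k h"
  using assms
proof (induction W arbitrary: h rule: finite_induct)
  case empty
  then have "h = (\<lambda>_. h (\<lambda>_. 0))"
    by (intro ext) (simp add: depends_on_def)
  then obtain a where h: "h = (\<lambda>_. a)" ..
  show ?case
    unfolding h using \<open>k > 0\<close> by (simp add: avg_cmult_right avg_const)
next
  case (insert w W)
  have g: "depends_on (- {w}) g" "depends_on (- W) g"
    by (rule depends_on_mono[OF insert.prems(4)], blast)+
  have w: "w < n" using insert.prems by auto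
  have "avg n k (\<lambda>x. g x * h x) = avg n k (resample k w (\<lambda>x. g x * h x))"
    using avg_resample[OF w \<open>k > 0\<close>] by simp
  also have "\<dots> = avg n k (\<lambda>x. g x * resample k w h x)"
    by (rule avg_cong) (rule resample_mult[OF g(1)])
  also have "\<dots> = avg n k g * avg n k (resample k w h)"
    using insert.prems by (intro insert.IH depends_on_resample g) auto
  finally show ?case
    using avg_resample[OF w \<open>k > 0\<close>] by simp
qed

section \<open>Centred agreement indicators of edges\<close>

definition cent :: "nat \<Rightarrow> (nat \<Rightarrow> nat) \<Rightarrow> nat \<times> nat \<Rightarrow> real" where
  "cent k x e = (if x (fst e) = x (snd e) then 1 else 0) - 1 / real k"

definition ends :: "nat \<times> nat \<Rightarrow> nat set" where
  "ends e = {fst e, snd e}"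

definition verts :: "(nat \<times> nat) set \<Rightarrow> nat set" where
  "verts S = (\<Union>e\<in>S. ends e)"

definition cprod :: "nat \<Rightarrow> (nat \<times> nat) set \<Rightarrow> (nat \<Rightarrow> nat) \<Rightarrow> real" where
  "cprod k S x = (\<Prod>e\<in>S. cent k x e)"

lemma depends_on_cent: "depends_on (ends e) (\<lambda>x. cent k x e)"
  by (simp add: depends_on_def ends_def cent_def)

lemma depends_on_cprod: "depends_on (verts S) (cprod k S)"
  unfolding depends_on_def
proof (intro allI impI)
  fix x y :: "nat \<Rightarrow> nat"
  assume *: "\<forall>i\<in>verts S. x i = y i"
  have "cent k x e = cent k y e" if "e \<in> S" for e
  proof -
    have "x (fst e) = y (fst e)" "x (snd e) = y (snd e)"
      using * that by (auto simp: verts_def ends_def)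
    then show ?thesis by (simp add: cent_def)
  qed
  then show "cprod k S x = cprod k S y"
    by (simp add: cprod_def)
qed

lemma abs_cent_le: "k > 0 \<Longrightarrow> \<bar>cent k x e\<bar> \<le> 1"
  by (auto simp: cent_def abs_if field_simps)

text \<open>With all labels but that of \<open>w\<close> fixed, exactly one of the \<open>k\<close>
  values for \<open>w\<close> agrees with the label of \<open>z\<close>, so the centred indicator
  averages to 0.\<close>

lemma avg_mult_cent_eq_0:
  assumes "ends e = {w, z}" "w \<noteq> z" "w < n" "z < n" "k > 0" "depends_on (- {w}) g"
  shows "avg n k (\<lambda>x. g x * cent k x e) = 0"
proof -
  have "avg n k (\<lambda>x. g x * cent k x e) = avg n k (resample k w (\<lambda>x. g x * cent k x e))"
    by (rule avg_resample[symmetric]) (use assms in auto)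
  also have "\<dots> = avg n k (\<lambda>_. 0)"
  proof (rule avg_cong)
    fix x assume "x \<in> PiE {..<n} (\<lambda>_. {..<k})"
    then have xz: "x z < k" using assms by (auto simp: PiE_iff)
    have eq: "cent k (x(w := b)) e = (if b = x z then 1 else 0) - 1 / real k" for b
      using assms(1,2) unfolding cent_def ends_def by (auto simp: doubleton_eq_iff)
    have "resample k w (\<lambda>x. cent k x e) x = 0"
      using xz \<open>k > 0\<close> by (simp add: resample_def eq sum_subtractf)
    then show "resample k w (\<lambda>x. g x * cent k x e) x = 0"
      by (simp add: resample_mult[OF assms(6)])
  qed
  finally show ?thesis by (simp add: avg_const assms)
qed

text \<open>With the other labels fixed, the absolute values over the \<open>k\<close> labels of
  \<open>w\<close> sum to at most 1 + \<open>k\<close> * (1/\<open>k\<close>) = 2. This is the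
  source of the factor 2/\<open>k\<close> paid per vertex.\<close>

lemma avg_mult_abs_cent_le:
  assumes "ends e = {w, z}" "w \<noteq> z" "w < n" "z < n" "k > 0" "depends_on (- {w}) g" "\<And>x. g x \<ge> 0"
  shows "avg n k (\<lambda>x. g x * \<bar>cent k x e\<bar>) \<le> 2 / real k * avg n k g"
proof -
  have "avg n k (\<lambda>x. g x * \<bar>cent k x e\<bar>) = avg n k (resample k w (\<lambda>x. g x * \<bar>cent k x e\<bar>))"
    by (rule avg_resample[symmetric]) (use assms in auto)
  also have "\<dots> \<le> avg n k (\<lambda>x. 2 / real k * g x)"
  proof (rule avg_mono)
    fix x assume "x \<in> PiE {..<n} (\<lambda>_. {..<k})"
    then have xz: "x z < k" using assms by (auto simp: PiE_iff)
    have "\<bar>cent k (x(w := b)) e\<bar> \<le> (if b = x z then 1 else 0) + 1 / real k" for b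
      using assms(1,2,5) unfolding cent_def ends_def by (auto simp: doubleton_eq_iff)
    then have "(\<Sum>b<k. \<bar>cent k (x(w := b)) e\<bar>) \<le> (\<Sum>b<k. (if b = x z then 1 else 0) + 1 / real k)"
      by (intro sum_mono) auto
    also have "\<dots> = 2"
      using xz \<open>k > 0\<close> by (simp add: sum.distrib)
    finally have "resample k w (\<lambda>x. \<bar>cent k x e\<bar>) x \<le> 2 / real k"
      by (simp add: resample_def divide_right_mono)
    then show "resample k w (\<lambda>x. g x * \<bar>cent k x e\<bar>) x \<le> 2 / real k * g x"
      using mult_left_mono[OF _ assms(7)[of x], of "resample k w (\<lambda>x. \<bar>cent k x e\<bar>) x" "2 / real k"]
      by (simp add: resample_mult[OF assms(6)] mult.commute)
  qed
  also have "\<dots> = 2 / real k * avg n k g" by (rule avg_cmult)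
  finally show ?thesis .
qed

text \<open>The labels agree with probability 1/\<open>k\<close>, so this is a Bernoulli
  variance.\<close>

lemma avg_cent_sq:
  assumes "u \<noteq> v" "u < n" "v < n" "k > 0"
  shows "avg n k (\<lambda>x. (cent k x (u, v))\<^sup>2) = (1 - 1 / real k) / real k"
proof -
  have "avg n k (\<lambda>x. (cent k x (u, v))\<^sup>2) = avg n k (resample k u (\<lambda>x. (cent k x (u, v))\<^sup>2))"
    by (rule avg_resample[symmetric]) (use assms in auto)
  also have "\<dots> = avg n k (\<lambda>_. (1 - 1 / real k) / real k)"
  proof (rule avg_cong)
    fix x assume "x \<in> PiE {..<n} (\<lambda>_. {..<k})"
    then have xz: "x v < k" using assms by (auto simp: PiE_iff)
    have "(cent k (x(u := b)) (u, v))\<^sup>2 = (if b = x v then 1 - 2 / real k else 0) + (1 / real k)\<^sup>2" for b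
      using assms unfolding cent_def by (auto simp: power2_eq_square field_simps)
    then have "(\<Sum>b<k. (cent k (x(u := b)) (u, v))\<^sup>2) = (1 - 2 / real k) + real k * (1 / real k)\<^sup>2"
      using xz by (simp add: sum.distrib)
    also have "\<dots> = 1 - 1 / real k"
      using \<open>k > 0\<close> by (simp add: power2_eq_square field_simps)
    finally show "resample k u (\<lambda>x. (cent k x (u, v))\<^sup>2) x = (1 - 1 / real k) / real k"
      by (simp add: resample_def)
  qed
  finally show ?thesis by (simp add: avg_const assms)
qed

section \<open>Cumulants\<close>

locale ssbm_pair =
  fixes n k u v :: nat
  assumes k2: "2 \<le> k" and u_less: "u < n" and v_less: "v < n" and u_neq_v: "u \<noteq> v"
begin

text \<open>The triangular system for the cumulants is solved for its top term \<open>kap S\<close>,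
  whose coefficient is the average of the empty product, 1.\<close>

function kap :: "(nat \<times> nat) set \<Rightarrow> real" where
  "kap S = (if finite S
     then avg n k (\<lambda>x. cent k x (u, v) * cprod k S x)
       - (\<Sum>T\<in>{T. T \<subset> S}. kap T * avg n k (cprod k (S - T)))
     else 0)"
  by auto
termination
  by (relation "Wellfounded.measure card") (auto intro: psubset_card_mono)

declare kap.simps[simp del]

end

section \<open>Incidence, and averages of products over edge sets\<close>

definition inc :: "(nat \<times> nat) set \<Rightarrow> nat \<Rightarrow> (nat \<times> nat) set" where
  "inc S w = {e \<in> S. w \<in> ends e}"

lemma finite_pairs: "finite (pairs n)"
  by (rule finite_subset[of _ "{..<n} \<times> {..<n}"]) (auto simp: pairs_def)

lemma finite_verts: "finite S \<Longrightarrow> finite (verts S)"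
  by (simp add: verts_def ends_def)

lemma verts_pairs: "S \<subseteq> pairs n \<Longrightarrow> verts S \<subseteq> {..<n}"
  by (auto simp: verts_def ends_def pairs_def)

lemma verts_mono: "S \<subseteq> T \<Longrightarrow> verts S \<subseteq> verts T"
  by (auto simp: verts_def)

lemma verts_Un: "verts (S \<union> T) = verts S \<union> verts T"
  by (auto simp: verts_def)

lemma verts_insert: "verts (insert e S) = ends e \<union> verts S"
  by (auto simp: verts_def)

lemma ends_pairsE:
  assumes "e \<in> pairs n" "w \<in> ends e"
  obtains z where "ends e = {w, z}" "w \<noteq> z" "w < n" "z < n"
proof -
  have "ends e = {w, fst e + snd e - w}" "w \<noteq> fst e + snd e - w" "w < n" "fst e + snd e - w < n"
    using assms by (auto simp: pairs_def ends_def)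
  then show ?thesis by (rule that)
qed

lemma cprod_Un: "finite A \<Longrightarrow> finite B \<Longrightarrow> A \<inter> B = {} \<Longrightarrow> cprod k (A \<union> B) x = cprod k A x * cprod k B x"
  by (simp add: cprod_def prod.union_disjoint)

lemma cprod_empty: "cprod k {} = (\<lambda>_. 1)"
  by (intro ext) (simp add: cprod_def)

lemma cprod_remove: "finite S \<Longrightarrow> e \<in> S \<Longrightarrow> cprod k S x = cprod k (S - {e}) x * cent k x e"
  by (simp add: cprod_def prod.remove mult.commute)

lemma abs_cprod_le: "k > 0 \<Longrightarrow> \<bar>cprod k S x\<bar> \<le> 1"
  unfolding cprod_def abs_prod by (intro prod_le_1) (auto intro: abs_cent_le)

text \<open>Only the edge \<open>e\<close> sees the label of the degree-one vertex \<open>w\<close>,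
  so averaging over that label alone already gives 0.\<close>

lemma avg_cprod_leaf:
  assumes "S \<subseteq> pairs n" "k > 0" "inc S w = {e}" "depends_on (- {w}) g"
  shows "avg n k (\<lambda>x. g x * cprod k S x) = 0"
proof -
  have e: "e \<in> S" "w \<in> ends e" using assms(3) by (auto simp: inc_def)
  then have "e \<in> pairs n" using assms by auto
  then obtain z where z: "ends e = {w, z}" "w \<noteq> z" "w < n" "z < n"
    using e(2) by (rule ends_pairsE)
  have fin: "finite S" using assms finite_pairs finite_subset by blast
  have "verts (S - {e}) \<subseteq> - {w}"
    using assms(3) by (auto simp: verts_def inc_def)
  then have dep: "depends_on (- {w}) (\<lambda>x. g x * cprod k (S - {e}) x)"
    by (intro depends_on_mult assms(4) depends_on_mono[OF depends_on_cprod])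
  have "avg n k (\<lambda>x. g x * cprod k S x) = avg n k (\<lambda>x. (g x * cprod k (S - {e}) x) * cent k x e)"
    by (simp add: cprod_remove[OF fin e(1)] mult.assoc)
  also have "\<dots> = 0"
    using avg_mult_cent_eq_0[OF z \<open>k > 0\<close> dep] .
  finally show ?thesis .
qed

text \<open>The last hypothesis lets \<open>U\<close> grow one vertex at a time along edges of
  \<open>R\<close> until it covers \<open>verts R\<close>. Each new vertex gains 2/\<open>k\<close>
  from the edge that reaches it, which is then absorbed into \<open>g\<close>; edges left over at
  the end are bounded by 1.\<close>

lemma avg_abs_cprod_le:
  assumes "R \<subseteq> pairs n" "k > 0" "\<And>x. g x \<ge> 0" "depends_on U g"
    and "\<And>U'. U \<subseteq> U' \<Longrightarrow> \<not> verts R \<subseteq> U' \<Longrightarrow> \<exists>e\<in>R. \<exists>a\<in>U'. \<exists>w. w \<notin> U' \<and> ends e = {w, a}"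
  shows "avg n k (\<lambda>x. g x * \<bar>cprod k R x\<bar>) \<le> (2 / real k) ^ card (verts R - U) * avg n k g"
  using assms
proof (induction "card (verts R - U)" arbitrary: R U g)
  case 0
  have "finite (verts R)" using 0 finite_pairs finite_subset finite_verts by metis
  then have "verts R - U = {}" using 0 by simp
  moreover have "avg n k (\<lambda>x. g x * \<bar>cprod k R x\<bar>) \<le> avg n k g"
    using 0 abs_cprod_le[OF \<open>k > 0\<close>] by (intro avg_mono mult_left_le) auto
  ultimately show ?case by (metis card.empty mult_1 power_0)
next
  case (Suc N)
  have fin: "finite R" using Suc.prems finite_pairs finite_subset by blast
  have "\<not> verts R \<subseteq> U" using Suc.hyps(2) by (metis Diff_eq_empty_iff card.empty nat.simps(3))
  then obtain e a w where e: "e \<in> R" "a \<in> U" "w \<notin> U" "ends e = {w, a}"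
    using Suc.prems(5)[of U] by blast
  have "e \<in> pairs n" using e Suc.prems by auto
  then have aw: "a \<noteq> w" "w < n" "a < n"
    using e(4) by (elim ends_pairsE[of e n w]; auto simp: doubleton_eq_iff)+
  define R' where "R' = R - {e}"
  define g' where "g' = (\<lambda>x. g x * \<bar>cent k x e\<bar>)"
  have vR: "verts R = ends e \<union> verts R'"
    unfolding R'_def using e by (auto simp: verts_def)
  then have "verts R - U = insert w (verts R' - insert w U)"
    using e by auto
  moreover have "finite (verts R')" using fin finite_verts by (simp add: R'_def)
  ultimately have card: "card (verts R - U) = Suc (card (verts R' - insert w U))"
    by simp
  have "avg n k (\<lambda>x. g' x * \<bar>cprod k R' x\<bar>) \<le> (2 / real k) ^ card (verts R' - insert w U) * avg n k g'"
  proof (rule Suc.hyps(1))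
    show "N = card (verts R' - insert w U)" using card Suc.hyps(2) by simp
    show "R' \<subseteq> pairs n" using Suc.prems by (auto simp: R'_def)
    show "depends_on (insert w U) g'"
      unfolding g'_def
      by (intro depends_on_mult depends_on_abs depends_on_mono[OF depends_on_cent]
          depends_on_mono[OF Suc.prems(4)]) (use e in auto)
    show "g' x \<ge> 0" for x using Suc.prems(3) by (simp add: g'_def)
    show "\<exists>e\<in>R'. \<exists>a\<in>U'. \<exists>w. w \<notin> U' \<and> ends e = {w, a}"
      if U': "insert w U \<subseteq> U'" "\<not> verts R' \<subseteq> U'" for U'
    proof -
      have "\<not> verts R \<subseteq> U'" using U' vR by auto
      then obtain e' a' w' where e': "e' \<in> R" "a' \<in> U'" "w' \<notin> U'" "ends e' = {w', a'}"
        using Suc.prems(5)[of U'] U'(1) by blast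
      \<comment> \<open>Both ends of \<open>e\<close> lie in \<open>U'\<close>, so \<open>e\<close>
        cannot leave \<open>U'\<close>, and the growth condition survives the removal of
        \<open>e\<close>.\<close>
      have "e' \<noteq> e" using e e' U' by auto
      then show ?thesis using e' unfolding R'_def by blast
    qed
  qed fact
  also have "\<dots> \<le> (2 / real k) ^ card (verts R' - insert w U) * (2 / real k * avg n k g)"
    unfolding g'_def
    by (intro mult_left_mono avg_mult_abs_cent_le[OF e(4)] depends_on_mono[OF Suc.prems(4)])
      (use aw e Suc.prems in auto)
  also have "\<dots> = (2 / real k) ^ card (verts R - U) * avg n k g"
    using card by simp
  finally show ?case
    by (simp add: g'_def R'_def cprod_remove[OF fin e(1)] abs_mult mult_ac)
qed

section \<open>Vanishing cumulants\<close>

context ssbm_pair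
begin

lemma k_pos: "k > 0" using k2 by simp

lemma finite_edges: "S \<subseteq> pairs n \<Longrightarrow> finite S"
  using finite_pairs finite_subset by blast

lemma sum_kap:
  assumes "finite S"
  shows "(\<Sum>T\<in>Pow S. kap T * avg n k (cprod k (S - T))) = avg n k (\<lambda>x. cent k x (u, v) * cprod k S x)"
proof -
  have "Pow S = insert S {T. T \<subset> S}" by auto
  moreover have "finite {T. T \<subset> S}" using assms by (auto intro: finite_subset[of _ "Pow S"])
  moreover have "avg n k (cprod k (S - S)) = 1"
    by (simp add: cprod_empty avg_const k_pos)
  ultimately have "(\<Sum>T\<in>Pow S. kap T * avg n k (cprod k (S - T)))
      = kap S + (\<Sum>T\<in>{T. T \<subset> S}. kap T * avg n k (cprod k (S - T)))"
    by simp
  then show ?thesis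
    using kap.simps[of S] assms by simp
qed

text \<open>In the recursion the leaf edge lies either in \<open>T\<close>, where the induction
  hypothesis kills \<open>kap T\<close>, or in \<open>S - T\<close>, where it kills the average. The
  leading moment vanishes for the same reason.\<close>

lemma kap_leaf:
  assumes "S \<subseteq> pairs n" "w \<notin> {u, v}" "inc S w = {e}"
  shows "kap S = 0"
  using assms
proof (induction "card S" arbitrary: S rule: less_induct)
  case less
  have fin: "finite S" using less finite_edges by auto
  have "depends_on (- {w}) (\<lambda>x. cent k x (u, v))"
    by (rule depends_on_mono[OF depends_on_cent]) (use less in \<open>auto simp: ends_def\<close>)
  then have 1: "avg n k (\<lambda>x. cent k x (u, v) * cprod k S x) = 0"
    using avg_cprod_leaf less.prems k_pos by blast
  have "kap T * avg n k (cprod k (S - T)) = 0" if T: "T \<subset> S" for T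
  proof (cases "e \<in> T")
    case True
    then have "inc T w = {e}" using less.prems T by (auto simp: inc_def)
    then have "kap T = 0"
      using less psubset_card_mono[OF fin T] T by blast
    then show ?thesis by simp
  next
    case False
    then have "inc (S - T) w = {e}" using less.prems T by (auto simp: inc_def)
    then have "avg n k (\<lambda>x. 1 * cprod k (S - T) x) = 0"
      using less.prems by (intro avg_cprod_leaf[where w = w]) (auto simp: k_pos depends_on_const)
    then show ?thesis by simp
  qed
  then have "(\<Sum>T\<in>{T. T \<subset> S}. kap T * avg n k (cprod k (S - T))) = 0"
    by (intro sum.neutral) blast
  then show ?case
    using 1 kap.simps[of S] by simp
qed

text \<open>Since \<open>B\<close> shares no vertex with \<open>A\<close>, \<open>u\<close> or
  \<open>v\<close>, the moments factor over \<open>A\<close> and \<open>B\<close>. By induction only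
  the terms with \<open>T \<subseteq> A\<close> survive in the recursion, and by
  \<open>sum_kap\<close> for \<open>A\<close> they already add up to the whole moment of
  \<open>A \<union> B\<close>.\<close>

lemma kap_split:
  assumes "A \<union> B \<subseteq> pairs n" "A \<inter> B = {}" "B \<noteq> {}" "verts B \<inter> (verts A \<union> {u, v}) = {}"
  shows "kap (A \<union> B) = 0"
  using assms
proof (induction "card (A \<union> B)" arbitrary: A B rule: less_induct)
  case less
  have fin: "finite (A \<union> B)" using less finite_edges by auto
  have fac: "avg n k (\<lambda>x. g x * cprod k C x * cprod k B x) = avg n k (\<lambda>x. g x * cprod k C x) * avg n k (cprod k B)"
    if "C \<subseteq> A" "depends_on {u, v} g" for C g
  proof (rule avg_indep)
    show "finite (verts B)" using fin finite_verts by auto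
    show "verts B \<subseteq> {..<n}" using less.prems verts_pairs by auto
    show "depends_on (verts B) (cprod k B)" by (rule depends_on_cprod)
    have "verts C \<subseteq> - verts B" using verts_mono[OF that(1)] less.prems by auto
    moreover have "{u, v} \<subseteq> - verts B" using less.prems by auto
    ultimately show "depends_on (- verts B) (\<lambda>x. g x * cprod k C x)"
      by (intro depends_on_mult depends_on_mono[OF that(2)] depends_on_mono[OF depends_on_cprod])
  qed (rule k_pos)
  have cross: "kap T = 0" if "T \<subset> A \<union> B" "\<not> T \<subseteq> A" for T
  proof -
    have "kap ((T \<inter> A) \<union> (T \<inter> B)) = 0"
    proof (rule less.hyps)
      have "T \<inter> A \<union> T \<inter> B = T" using that by auto
      then show "card (T \<inter> A \<union> T \<inter> B) < card (A \<union> B)"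
        using psubset_card_mono[OF fin that(1)] by simp
      show "verts (T \<inter> B) \<inter> (verts (T \<inter> A) \<union> {u, v}) = {}"
        using less.prems(4) verts_mono[of "T \<inter> A" A] verts_mono[of "T \<inter> B" B] by blast
    qed (use less.prems that in auto)
    moreover have "(T \<inter> A) \<union> (T \<inter> B) = T" using that by auto
    ultimately show ?thesis by simp
  qed
  have "(\<Sum>T\<in>{T. T \<subset> A \<union> B}. kap T * avg n k (cprod k ((A \<union> B) - T)))
      = (\<Sum>T\<in>Pow A. kap T * avg n k (cprod k ((A \<union> B) - T)))"
  proof (rule sum.mono_neutral_right)
    show "finite {T. T \<subset> A \<union> B}" using fin by (auto intro: finite_subset[of _ "Pow (A \<union> B)"])
    show "Pow A \<subseteq> {T. T \<subset> A \<union> B}" using less.prems by auto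
  qed (use cross in auto)
  also have "\<dots> = (\<Sum>T\<in>Pow A. kap T * avg n k (cprod k (A - T)) * avg n k (cprod k B))"
  proof (rule sum.cong[OF refl])
    fix T assume "T \<in> Pow A"
    then have "A \<union> B - T = (A - T) \<union> B" using less.prems by auto
    moreover have "cprod k ((A - T) \<union> B) = (\<lambda>x. 1 * cprod k (A - T) x * cprod k B x)"
      using fin less.prems by (intro ext, subst cprod_Un) auto
    moreover have "avg n k (\<lambda>x. 1 * cprod k (A - T) x * cprod k B x)
       = avg n k (\<lambda>x. 1 * cprod k (A - T) x) * avg n k (cprod k B)"
      by (rule fac) (auto simp: depends_on_const)
    ultimately show "kap T * avg n k (cprod k (A \<union> B - T))
       = kap T * avg n k (cprod k (A - T)) * avg n k (cprod k B)"
      by simp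
  qed
  also have "\<dots> = avg n k (\<lambda>x. cent k x (u, v) * cprod k A x) * avg n k (cprod k B)"
    using sum_kap[of A] fin by (simp add: sum_distrib_right[symmetric])
  also have "\<dots> = avg n k (\<lambda>x. cent k x (u, v) * cprod k A x * cprod k B x)"
    using depends_on_cent[of "(u, v)"] by (intro fac[symmetric]) (auto simp: ends_def)
  also have "\<dots> = avg n k (\<lambda>x. cent k x (u, v) * cprod k (A \<union> B) x)"
    using fin less.prems by (simp add: cprod_Un mult.assoc)
  finally show ?case
    using kap.simps[of "A \<union> B"] by simp
qed

lemma kap_empty: "kap {} = 0"
proof -
  have "avg n k (\<lambda>x. 1 * cent k x (u, v)) = 0"
    by (rule avg_mult_cent_eq_0[where w = u and z = v])
      (auto simp: ends_def u_less v_less u_neq_v k_pos depends_on_const)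
  then show ?thesis
    using kap.simps[of "{}"] by (simp add: cprod_empty)
qed

text \<open>This is connectedness of \<open>S\<close> together with the edge uv, phrased as growth:
  every proper subset can be extended by an edge touching it or touching \<open>u\<close>,
  \<open>v\<close>. All later explorations of \<open>S\<close> run on this form.\<close>

definition linked :: "(nat \<times> nat) set \<Rightarrow> bool" where
  "linked S \<longleftrightarrow> (\<forall>A. A \<subset> S \<longrightarrow> (\<exists>e\<in>S - A. ends e \<inter> (verts A \<union> {u, v}) \<noteq> {}))"

definition admissible :: "(nat \<times> nat) set \<Rightarrow> bool" where
  "admissible S \<longleftrightarrow> S \<noteq> {} \<and> S \<subseteq> pairs n \<and> (\<forall>w\<in>verts S - {u, v}. 2 \<le> card (inc S w)) \<and> linked S"

lemma kap_nonzero: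
  assumes "S \<subseteq> pairs n" "kap S \<noteq> 0"
  shows "admissible S"
proof -
  have "2 \<le> card (inc S w)" if w: "w \<in> verts S - {u, v}" for w
  proof -
    have fin: "finite (inc S w)" using assms finite_edges by (simp add: inc_def)
    obtain e where "e \<in> S" "w \<in> ends e" using w unfolding verts_def by blast
    then have "inc S w \<noteq> {}" unfolding inc_def by blast
    then have "card (inc S w) \<noteq> 0" using fin by simp
    moreover have "card (inc S w) \<noteq> 1"
      using kap_leaf[of S w] assms w by (auto simp: card_1_singleton_iff)
    ultimately show ?thesis by linarith
  qed
  moreover have "linked S"
    unfolding linked_def
  proof (intro allI impI, rule ccontr)
    fix A assume A: "A \<subset> S" and "\<not> (\<exists>e\<in>S - A. ends e \<inter> (verts A \<union> {u, v}) \<noteq> {})"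
    then have "verts (S - A) \<inter> (verts A \<union> {u, v}) = {}" by (auto simp: verts_def)
    moreover have "A \<union> (S - A) = S" using A by auto
    ultimately show False using kap_split[of A "S - A"] A assms by auto
  qed
  ultimately show ?thesis
    using assms kap_empty by (auto simp: admissible_def)
qed

end

section \<open>Cumulant bounds through branching edges\<close>

lemma sum_card_inc:
  assumes "S \<subseteq> pairs n" "verts S \<subseteq> V" "finite V"
  shows "(\<Sum>w\<in>V. card (inc S w)) = 2 * card S"
proof -
  have fin: "finite S" using assms finite_pairs finite_subset by blast
  have "(\<Sum>w\<in>V. card (inc S w)) = (\<Sum>w\<in>V. \<Sum>e\<in>S. if w \<in> ends e then 1 else 0)"
    using fin by (simp add: inc_def sum.If_cases Int_def)
  also have "\<dots> = (\<Sum>e\<in>S. \<Sum>w\<in>V. if w \<in> ends e then 1 else 0)"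
    by (rule sum.swap)
  also have "\<dots> = (\<Sum>e\<in>S. 2)"
  proof (rule sum.cong[OF refl])
    fix e assume e: "e \<in> S"
    then have "ends e \<subseteq> V" using assms unfolding verts_def by blast
    then have "V \<inter> ends e = ends e" by blast
    moreover have "fst e \<noteq> snd e" using assms e by (auto simp: pairs_def)
    then have "card (ends e) = 2" by (simp add: ends_def)
    moreover have "(\<Sum>w\<in>V. if w \<in> ends e then 1 else 0 :: nat) = card (V \<inter> ends e)"
      using assms by (simp add: sum.If_cases)
    ultimately show "(\<Sum>w\<in>V. if w \<in> ends e then 1 else 0 :: nat) = 2"
      by simp
  qed
  finally show ?thesis by simp
qed

lemma sum_power_card_Pow:
  fixes D :: real
  assumes "finite B"
  shows "(\<Sum>Q\<in>Pow B. D ^ card Q) = (1 + D) ^ card B"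
  using prod_add[of B "\<lambda>_. D" "\<lambda>_. 1"] assms
  by (simp add: add.commute)

text \<open>This closes the induction for the cumulants: 1 stands for the leading moment and the
  difference for the proper subsets of the branching edges. Bernoulli gives
  \<open>(D / (D + 1)) ^ b\<close> >= 3/4, so the difference is at most a third of
  \<open>D ^ b\<close>, and \<open>D\<close> >= 4 leaves room for the 1.\<close>

lemma power_Suc_base_bound:
  fixes D :: real
  assumes "1 \<le> b" "b \<le> l" "D = 4 * real l + 4"
  shows "1 + (1 + D) ^ b - D ^ b \<le> D ^ b"
proof -
  have D: "D \<ge> 4" using assms by simp
  have "1 + real b * (- (1 / (D + 1))) \<le> (1 + (- (1 / (D + 1)))) ^ b"
    using D by (intro Bernoulli_inequality) simp
  moreover have "real b / (D + 1) \<le> 1 / 4"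
    using assms by (simp add: field_simps)
  ultimately have "3 / 4 \<le> (1 - 1 / (D + 1)) ^ b" by simp
  also have "1 - 1 / (D + 1) = D / (D + 1)" using D by (simp add: field_simps)
  finally have "3 / 4 * (1 + D) ^ b \<le> D ^ b"
    using D by (simp add: field_simps)
  moreover have "D ^ 1 \<le> D ^ b" using assms D by (intro power_increasing) auto
  ultimately show ?thesis using D by simp
qed

context ssbm_pair
begin

text \<open>The vertices \<open>u\<close> and \<open>v\<close> count even if \<open>S\<close> misses
  them, because the edge uv always takes part in the moment.\<close>

definition vcount :: "(nat \<times> nat) set \<Rightarrow> nat" where
  "vcount S = card (verts S \<union> {u, v})"

text \<open>For admissible \<open>S\<close> the edges left out run between vertices of degree
  exactly two, that is, inside paths.\<close>

definition branch_edges :: "(nat \<times> nat) set \<Rightarrow> (nat \<times> nat) set" where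
  "branch_edges S = {e \<in> S. \<exists>w\<in>ends e. w \<in> {u, v} \<or> 3 \<le> card (inc S w)}"

lemma vcount_eq:
  assumes "finite S"
  shows "vcount S = card (verts S - {u, v}) + 2"
proof -
  have "verts S \<union> {u, v} = (verts S - {u, v}) \<union> {u, v}" by blast
  then have "card (verts S \<union> {u, v}) = card (verts S - {u, v}) + card {u, v}"
    using card_Un_disjoint[of "verts S - {u, v}" "{u, v}"] finite_verts[OF assms] by simp
  then show ?thesis using u_neq_v by (simp add: vcount_def)
qed

text \<open>With p vertices besides \<open>u\<close>, \<open>v\<close> and p + j edges this bounds
  the branching edges by 6j. Each vertex of degree d is charged 3d, which pays 6 if d = 2 and d + 6
  if d >= 3; \<open>u\<close> and \<open>v\<close> receive an extra 6 each. The degrees sum to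
  \<open>2 * card S\<close>.\<close>

lemma branch_edges_vcount:
  assumes "admissible S"
  shows "card (branch_edges S) + 6 * vcount S \<le> 6 * card S + 12"
proof -
  let ?V = "verts S \<union> {u, v}"
  let ?br = "\<lambda>w. w \<in> {u, v} \<or> 3 \<le> card (inc S w)"
  have S: "S \<subseteq> pairs n" using assms by (simp add: admissible_def)
  have fin: "finite S" by (rule finite_edges[OF S])
  have finV: "finite ?V" using finite_verts[OF fin] by simp
  have fininc: "finite (inc S w)" for w using fin by (simp add: inc_def)
  have "branch_edges S \<subseteq> (\<Union>w\<in>{w\<in>?V. ?br w}. inc S w)"
    unfolding branch_edges_def inc_def verts_def by blast
  then have "card (branch_edges S) \<le> card (\<Union>w\<in>{w\<in>?V. ?br w}. inc S w)"
    using finV fininc by (intro card_mono) auto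
  also have "\<dots> \<le> (\<Sum>w\<in>{w\<in>?V. ?br w}. card (inc S w))"
    using finV by (intro card_UN_le) auto
  also have "\<dots> = (\<Sum>w\<in>?V. if ?br w then card (inc S w) else 0)"
    using finV by (simp only: sum.inter_filter)
  finally have "card (branch_edges S) + 6 * vcount S
      \<le> (\<Sum>w\<in>?V. (if ?br w then card (inc S w) else 0) + 6)"
    unfolding sum.distrib vcount_def by simp
  also have "\<dots> \<le> (\<Sum>w\<in>?V. 3 * card (inc S w) + (if w \<in> {u, v} then 6 else 0))"
  proof (rule sum_mono)
    fix w assume "w \<in> ?V"
    then have "w \<in> {u, v} \<or> 2 \<le> card (inc S w)"
      using assms unfolding admissible_def by blast
    then show "(if ?br w then card (inc S w) else 0) + 6
        \<le> 3 * card (inc S w) + (if w \<in> {u, v} then 6 else 0)"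
      by (simp split: if_splits) linarith
  qed
  also have "\<dots> = 3 * (\<Sum>w\<in>?V. card (inc S w)) + (\<Sum>w\<in>?V. if w \<in> {u, v} then 6 else 0)"
    by (simp add: sum.distrib sum_distrib_left)
  also have "(\<Sum>w\<in>?V. if w \<in> {u, v} then 6 else 0) = (12 :: nat)"
  proof -
    have "?V \<inter> {u, v} = {u, v}" by blast
    then show ?thesis
      using finV u_neq_v sum.inter_restrict[of ?V "\<lambda>_. 6 :: nat" "{u, v}"] by simp
  qed
  also have "(\<Sum>w\<in>?V. card (inc S w)) = 2 * card S"
    using finV S by (intro sum_card_inc) auto
  finally show ?thesis by simp
qed

lemma branch_edges_nonempty:
  assumes "admissible S"
  shows "branch_edges S \<noteq> {}"
proof -
  have "{} \<subset> S" "linked S" using assms by (auto simp: admissible_def)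
  then have "\<exists>e\<in>S - {}. ends e \<inter> (verts {} \<union> {u, v}) \<noteq> {}"
    unfolding linked_def by blast
  then show ?thesis
    unfolding branch_edges_def verts_def by blast
qed

text \<open>Along a path of degree-two vertices a leafless subgraph contains all edges or none.\<close>

lemma leafless_determined:
  assumes "admissible S" "T1 \<subseteq> S" "T2 \<subseteq> S"
    and leafless: "\<And>w. card (inc (S - T1) w) \<noteq> 1" "\<And>w. card (inc (S - T2) w) \<noteq> 1"
    and eq: "branch_edges S \<inter> T1 = branch_edges S \<inter> T2"
  shows "T1 = T2"
proof -
  \<comment> \<open>\<open>X\<close> collects the edges on which \<open>T1\<close> and
    \<open>T2\<close> agree. If some edge is missing, linkedness gives a disagreeing edge
    \<open>e\<close> at a vertex \<open>w\<close> of \<open>X\<close> or at \<open>u\<close>,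
    \<open>v\<close>. It is no branching edge, so \<open>w\<close> has just two edges,
    \<open>e\<close> and some \<open>e'\<close> in \<open>X\<close>; without a leaf at
    \<open>w\<close> both are removed or both remain, so agreement spreads from \<open>e'\<close> to
    \<open>e\<close>.\<close>
  define X where "X = {e \<in> S. e \<in> T1 \<longleftrightarrow> e \<in> T2}"
  have "X = S"
  proof (rule ccontr)
    assume "X \<noteq> S"
    then have "X \<subset> S" by (auto simp: X_def)
    then obtain e w where e: "e \<in> S" "e \<notin> X" "w \<in> ends e" "w \<in> verts X \<union> {u, v}"
      using assms(1) unfolding admissible_def linked_def by blast
    have fin: "finite S" using assms finite_edges by (simp add: admissible_def)
    have "e \<notin> branch_edges S" using e eq unfolding X_def by blast
    then have w: "w \<notin> {u, v}" "card (inc S w) \<le> 2"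
      using e unfolding branch_edges_def by auto
    then obtain e' where e': "e' \<in> X" "w \<in> ends e'"
      using e unfolding verts_def by blast
    have ee: "e \<noteq> e'" using e e' by blast
    have "{e, e'} \<subseteq> inc S w" using e e' unfolding inc_def X_def by blast
    moreover have "finite (inc S w)" using fin by (simp add: inc_def)
    moreover have "card {e, e'} = 2" using ee by simp
    ultimately have "{e, e'} = inc S w"
      using w card_seteq by metis
    moreover have "inc (S - T) w = inc S w - T" for T unfolding inc_def by blast
    ultimately have inc: "inc (S - T) w = {e, e'} - T" for T by simp
    have both: "e \<in> T \<longleftrightarrow> e' \<in> T" if "card (inc (S - T) w) \<noteq> 1" for T
    proof (rule ccontr)
      assume "\<not> (e \<in> T \<longleftrightarrow> e' \<in> T)"
      then have "{e, e'} - T = {e} \<or> {e, e'} - T = {e'}" using ee by blast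
      then show False using that unfolding inc by auto
    qed
    have "e \<in> T1 \<longleftrightarrow> e \<in> T2"
      using both[OF leafless(1)] both[OF leafless(2)] e' by (simp add: X_def)
    then show False using e by (simp add: X_def)
  qed
  then show ?thesis using assms(2,3) unfolding X_def by blast
qed

text \<open>This turns linkedness into the growth condition of \<open>avg_abs_cprod_le\<close>:
  apply it to the edges lying inside \<open>U\<close>. An edge leaving \<open>U\<close> cannot
  belong to \<open>T\<close>, whose vertices are all in \<open>U\<close>.\<close>

lemma linked_boundary:
  assumes "linked S" "T \<subseteq> S" "verts T \<union> {u, v} \<subseteq> U" "\<not> verts S \<subseteq> U"
  shows "\<exists>e\<in>S - T. \<exists>a\<in>U. \<exists>w. w \<notin> U \<and> ends e = {w, a}"
proof -
  define A where "A = {e \<in> S. ends e \<subseteq> U}"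
  have "A \<noteq> S" using assms(4) unfolding A_def verts_def by blast
  then have "A \<subset> S" by (auto simp: A_def)
  then obtain e a where e: "e \<in> S" "e \<notin> A" "a \<in> ends e" "a \<in> verts A \<union> {u, v}"
    using assms(1) unfolding linked_def by blast
  have a: "a \<in> U" using e(4) assms(3) unfolding A_def verts_def by blast
  obtain w where w: "w \<in> ends e" "w \<notin> U" using e unfolding A_def by blast
  have "ends e = {w, a}" using w a e(3) unfolding ends_def by auto
  moreover have "e \<notin> T" using w assms(3) unfolding verts_def by blast
  ultimately show ?thesis using e a w by blast
qed

lemma abs_avg_cprod_le:
  assumes "linked S" "S \<subseteq> pairs n" "T \<subseteq> S"
  shows "\<bar>avg n k (cprod k (S - T))\<bar> \<le> (2 / real k) ^ (vcount S - vcount T)"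
proof -
  let ?U = "verts T \<union> {u, v}"
  have fin: "finite S" "finite T" using assms finite_edges finite_subset by auto
  have "avg n k (\<lambda>x. 1 * \<bar>cprod k (S - T) x\<bar>)
      \<le> (2 / real k) ^ card (verts (S - T) - ?U) * avg n k (\<lambda>_. 1)"
  proof (rule avg_abs_cprod_le)
    show "\<exists>e\<in>S - T. \<exists>a\<in>U'. \<exists>w. w \<notin> U' \<and> ends e = {w, a}"
      if "?U \<subseteq> U'" "\<not> verts (S - T) \<subseteq> U'" for U'
      using linked_boundary[OF assms(1,3) that(1)] that(2) verts_mono[of "S - T" S] by blast
  qed (use assms k_pos in \<open>auto simp: depends_on_const\<close>)
  moreover have "card (verts (S - T) - ?U) = vcount S - vcount T"
  proof -
    have "verts S = verts (S - T) \<union> verts T"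
      using assms(3) verts_Un[of "S - T" T] by (simp add: Un_absorb2)
    then have "verts (S - T) - ?U = (verts S \<union> {u, v}) - ?U" by blast
    then show ?thesis
      unfolding vcount_def using finite_verts[OF fin(2)] verts_mono[OF assms(3)]
      by (metis Un_mono card_Diff_subset finite.emptyI finite.insertI finite_Un order_refl)
  qed
  ultimately show ?thesis
    using abs_avg_le[of n k "cprod k (S - T)"] by (simp add: avg_const k_pos)
qed

text \<open>The exploration from \<open>u\<close>, \<open>v\<close> gives one factor
  2/\<open>k\<close> per further vertex, and the indicator of uv itself gives one more, hence the
  exponent \<open>vcount S - 1\<close>.\<close>

lemma abs_avg_cent_cprod_le:
  assumes "linked S" "S \<subseteq> pairs n"
  shows "\<bar>avg n k (\<lambda>x. cent k x (u, v) * cprod k S x)\<bar> \<le> (2 / real k) ^ (vcount S - 1)"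
proof -
  have fin: "finite S" using assms finite_edges by auto
  have "\<bar>avg n k (\<lambda>x. cent k x (u, v) * cprod k S x)\<bar>
      \<le> avg n k (\<lambda>x. \<bar>cent k x (u, v)\<bar> * \<bar>cprod k S x\<bar>)"
    using abs_avg_le[of n k "\<lambda>x. cent k x (u, v) * cprod k S x"] by (simp add: abs_mult)
  also have "\<dots> \<le> (2 / real k) ^ card (verts S - {u, v}) * avg n k (\<lambda>x. \<bar>cent k x (u, v)\<bar>)"
  proof (rule avg_abs_cprod_le)
    show "depends_on {u, v} (\<lambda>x. \<bar>cent k x (u, v)\<bar>)"
      using depends_on_abs[OF depends_on_cent[of "(u, v)" k]] by (simp add: ends_def)
    show "\<exists>e\<in>S. \<exists>a\<in>U'. \<exists>w. w \<notin> U' \<and> ends e = {w, a}"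
      if "{u, v} \<subseteq> U'" "\<not> verts S \<subseteq> U'" for U'
      using linked_boundary[OF assms(1), of "{}" U'] that by (simp add: verts_def)
  qed (use assms k_pos in auto)
  also have "\<dots> \<le> (2 / real k) ^ card (verts S - {u, v}) * (2 / real k)"
  proof (rule mult_left_mono)
    have "avg n k (\<lambda>x. 1 * \<bar>cent k x (u, v)\<bar>) \<le> 2 / real k * avg n k (\<lambda>_. 1)"
      by (rule avg_mult_abs_cent_le[where w = u and z = v])
        (auto simp: ends_def u_less v_less u_neq_v k_pos depends_on_const)
    then show "avg n k (\<lambda>x. \<bar>cent k x (u, v)\<bar>) \<le> 2 / real k"
      by (simp add: avg_const k_pos)
  qed auto
  also have "\<dots> = (2 / real k) ^ (vcount S - 1)"
    by (simp add: vcount_eq[OF fin])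
  finally show ?thesis .
qed

text \<open>In the recursion the bounds for \<open>kap T\<close> and for the average over
  \<open>S - T\<close> multiply to the same power of 2/\<open>k\<close> for every \<open>T\<close>,
  so only a combinatorial factor accumulates. The contributing \<open>T\<close> are determined by
  their trace on the branching edges, which makes this factor exponential in the number of those
  edges rather than in \<open>card S\<close>.\<close>

lemma abs_kap_le:
  assumes "S \<subseteq> pairs n" "card S \<le> l"
  shows "\<bar>kap S\<bar> \<le> (2 / real k) ^ (vcount S - 1) * (4 * real l + 4) ^ card (branch_edges S)"
  using assms
proof (induction "card S" arbitrary: S rule: less_induct)
  case less
  define D :: real where "D = 4 * real l + 4"
  define P where "P = (2 / real k) ^ (vcount S - 1)"
  have P0: "P \<ge> 0" by (simp add: P_def)
  have D1: "D \<ge> 1" by (simp add: D_def)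
  show ?case
  proof (cases "kap S = 0")
    case True
    then show ?thesis by simp
  next
    case False
    then have adm: "admissible S" using kap_nonzero less.prems by blast
    then have linked: "linked S" by (simp add: admissible_def)
    have fin: "finite S" using less finite_edges by auto
    let ?B = "branch_edges S"
    have BS: "?B \<subseteq> S" by (auto simp: branch_edges_def)
    have finB: "finite ?B" using BS fin finite_subset by blast
    \<comment> \<open>Outside \<open>G\<close> the graph \<open>S - T\<close> has a leaf and the
      average over it vanishes.\<close>
    define G where "G = {T. T \<subset> S \<and> (\<forall>w. card (inc (S - T) w) \<noteq> 1)}"
    have finPS: "finite {T. T \<subset> S}" using fin by (auto intro: finite_subset[of _ "Pow S"])
    have term_le: "\<bar>kap T * avg n k (cprod k (S - T))\<bar> \<le> P * D ^ card (?B \<inter> T)" if T: "T \<subset> S" for T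
    proof -
      have "finite T" using T fin finite_subset by blast
      have "\<bar>kap T\<bar> \<le> (2 / real k) ^ (vcount T - 1) * D ^ card (branch_edges T)"
        unfolding D_def using less T psubset_card_mono[OF fin T] by (intro less.hyps) auto
      \<comment> \<open>Degrees only drop when passing from \<open>S\<close> to \<open>T\<close>, so
        edges branching in \<open>T\<close> also branch in \<open>S\<close>.\<close>
      moreover have "card (branch_edges T) \<le> card (?B \<inter> T)"
      proof (rule card_mono)
        have "card (inc T w) \<le> card (inc S w)" for w
          using T fin by (intro card_mono) (auto simp: inc_def)
        then show "branch_edges T \<subseteq> ?B \<inter> T"
          using T unfolding branch_edges_def by (blast intro: order_trans)
      qed (use finB in simp)
      then have "D ^ card (branch_edges T) \<le> D ^ card (?B \<inter> T)"
        using D1 by (intro power_increasing) auto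
      ultimately have 1: "\<bar>kap T\<bar> \<le> (2 / real k) ^ (vcount T - 1) * D ^ card (?B \<inter> T)"
        by (meson mult_left_mono order_trans zero_le_divide_iff zero_le_power of_nat_0_le_iff zero_le_numeral)
      have "\<bar>kap T * avg n k (cprod k (S - T))\<bar>
          \<le> ((2 / real k) ^ (vcount T - 1) * D ^ card (?B \<inter> T)) * (2 / real k) ^ (vcount S - vcount T)"
        unfolding abs_mult using T less.prems D1
        by (intro mult_mono 1 abs_avg_cprod_le[OF linked]) auto
      also have "\<dots> = (2 / real k) ^ (vcount T - 1 + (vcount S - vcount T)) * D ^ card (?B \<inter> T)"
        by (simp add: power_add)
      also have "vcount T - 1 + (vcount S - vcount T) = vcount S - 1"
      proof -
        have "vcount T \<le> vcount S"
          unfolding vcount_def using finite_verts[OF fin] verts_mono[of T S] T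
          by (intro card_mono) auto
        then show ?thesis using vcount_eq[OF \<open>finite T\<close>] by simp
      qed
      finally show ?thesis by (simp add: P_def)
    qed
    have zero: "kap T * avg n k (cprod k (S - T)) = 0" if T: "T \<in> {T. T \<subset> S} - G" for T
    proof -
      obtain w e where "inc (S - T) w = {e}"
        using T unfolding G_def by (auto simp: card_1_singleton_iff)
      then have "avg n k (\<lambda>x. 1 * cprod k (S - T) x) = 0"
        using less.prems by (intro avg_cprod_leaf[where w = w]) (auto simp: k_pos depends_on_const)
      then show ?thesis by simp
    qed
    \<comment> \<open>Including \<open>S\<close> itself shows that no \<open>T\<close> in
      \<open>G\<close> has the full trace, so the sum below runs over proper subsets of the
      branching edges only.\<close>
    have inj: "inj_on (\<lambda>T. ?B \<inter> T) (insert S G)"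
    proof (rule inj_onI)
      fix T1 T2 assume *: "T1 \<in> insert S G" "T2 \<in> insert S G" "?B \<inter> T1 = ?B \<inter> T2"
      have leafless: "T \<subseteq> S \<and> (\<forall>w. card (inc (S - T) w) \<noteq> 1)" if "T \<in> insert S G" for T
      proof (cases "T = S")
        case True
        moreover have "inc (S - S) w = {}" for w by (simp add: inc_def)
        ultimately show ?thesis by simp
      next
        case False
        then show ?thesis using that unfolding G_def by blast
      qed
      show "T1 = T2"
        by (rule leafless_determined[OF adm]) (use * leafless in blast)+
    qed
    have img: "(\<lambda>T. ?B \<inter> T) ` G \<subseteq> Pow ?B - {?B}"
    proof -
      have "?B \<inter> T \<noteq> ?B" if "T \<in> G" for T
      proof
        assume "?B \<inter> T = ?B"
        then have "?B \<inter> T = ?B \<inter> S" using BS by blast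
        then have "T = S" using inj that unfolding inj_on_def by blast
        then show False using that by (simp add: G_def)
      qed
      then show ?thesis by blast
    qed
    have "\<bar>\<Sum>T\<in>{T. T \<subset> S}. kap T * avg n k (cprod k (S - T))\<bar>
        = \<bar>\<Sum>T\<in>G. kap T * avg n k (cprod k (S - T))\<bar>"
      using finPS zero by (subst sum.mono_neutral_right[of _ G]) (auto simp: G_def)
    also have "\<dots> \<le> (\<Sum>T\<in>G. P * D ^ card (?B \<inter> T))"
      by (rule order_trans[OF sum_abs sum_mono]) (use term_le in \<open>auto simp: G_def\<close>)
    also have "\<dots> = P * (\<Sum>Q\<in>(\<lambda>T. ?B \<inter> T) ` G. D ^ card Q)"
      using inj by (subst sum.reindex) (auto simp: sum_distrib_left intro: inj_on_subset)
    also have "\<dots> \<le> P * (\<Sum>Q\<in>Pow ?B - {?B}. D ^ card Q)"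
      using finB img D1 P0 by (intro mult_left_mono sum_mono2) auto
    also have "\<dots> = P * ((1 + D) ^ card ?B - D ^ card ?B)"
      using finB by (simp add: sum_diff1 sum_power_card_Pow)
    finally have rest: "\<bar>\<Sum>T\<in>{T. T \<subset> S}. kap T * avg n k (cprod k (S - T))\<bar>
        \<le> P * ((1 + D) ^ card ?B - D ^ card ?B)" .
    have "\<bar>kap S\<bar> \<le> P + P * ((1 + D) ^ card ?B - D ^ card ?B)"
      using rest abs_avg_cent_cprod_le[OF linked less.prems(1)] kap.simps[of S] fin
      by (simp add: P_def)
    also have "\<dots> = P * (1 + (1 + D) ^ card ?B - D ^ card ?B)"
      by (simp add: algebra_simps)
    also have "\<dots> \<le> P * D ^ card ?B"
    proof (rule mult_left_mono[OF power_Suc_base_bound P0])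
      show "1 \<le> card ?B" using branch_edges_nonempty[OF adm] finB by (simp add: Suc_le_eq card_gt_0_iff)
      show "card ?B \<le> l" using card_mono[OF fin BS] less.prems by simp
    qed (rule D_def)
    finally show ?thesis by (simp add: P_def D_def)
  qed
qed

end

section \<open>Counting the contributing edge sets\<close>

definition edge :: "nat \<Rightarrow> nat \<Rightarrow> nat \<times> nat" where
  "edge a b = (min a b, max a b)"

lemma ends_edge: "ends (edge a b) = {a, b}"
  by (auto simp: ends_def edge_def min_def max_def)

lemma edge_ends: "e \<in> pairs n \<Longrightarrow> ends e = {a, b} \<Longrightarrow> e = edge a b"
  by (auto simp: ends_def edge_def pairs_def doubleton_eq_iff)

context ssbm_pair
begin

text \<open>A state records an edge set and the vertex at which the exploration currently stands. A step
  to a fresh vertex continues from there and costs a factor \<open>n\<close>; a step closing a cycle costs two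
  choices among the few vertices seen so far. Leaflessness guarantees that the exploration is never
  stuck at a fresh vertex.\<close>

inductive reach :: "nat \<Rightarrow> nat \<Rightarrow> (nat \<times> nat) set \<Rightarrow> nat \<Rightarrow> bool" where
  start: "z \<in> {u, v} \<Longrightarrow> reach 0 0 {} z"
| fresh: "reach p j H z \<Longrightarrow> w < n \<Longrightarrow> w \<notin> verts H \<union> {u, v} \<Longrightarrow> reach (Suc p) j (insert (edge z w) H) w"
| close: "reach p j H z \<Longrightarrow> t \<in> verts H \<union> {u, v} \<Longrightarrow> s \<in> verts H \<union> {u, v} \<Longrightarrow> edge z t \<notin> H
    \<Longrightarrow> reach p (Suc j) (insert (edge z t) H) s"

text \<open>Here \<open>p\<close> counts the fresh vertices and \<open>j\<close> the closing edges;
  the starting vertices \<open>u\<close>, \<open>v\<close> give the 2.\<close>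

lemma reach_invariants:
  "reach p j H z \<Longrightarrow> finite H \<and> card H = p + j \<and> z \<in> verts H \<union> {u, v} \<and> vcount H = p + 2"
proof (induction rule: reach.induct)
  case (start z)
  then show ?case using u_neq_v by (auto simp: vcount_def verts_def)
next
  case (fresh p j H z w)
  have "edge z w \<notin> H"
  proof
    assume "edge z w \<in> H"
    then have "w \<in> verts H" using ends_edge[of z w] unfolding verts_def by blast
    then show False using fresh by simp
  qed
  moreover have "verts (insert (edge z w) H) \<union> {u, v} = insert w (verts H \<union> {u, v})"
    using fresh by (auto simp: verts_insert ends_edge)
  moreover have "finite (verts H \<union> {u, v})"
    using fresh finite_verts by simp
  ultimately show ?case using fresh
    unfolding vcount_def by (simp add: verts_insert ends_edge)
next
  case (close p j H z t s)
  then have "verts (insert (edge z t) H) \<union> {u, v} = verts H \<union> {u, v}"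
    by (auto simp: verts_insert ends_edge)
  then show ?case using close
    unfolding vcount_def by auto
qed

lemma reach_cover:
  assumes adm: "admissible S" and H: "H \<subset> S" and "reach p j H z"
    and "e \<in> S - H" "z \<in> ends e"
  shows "\<exists>p j z. reach p j S z"
  using assms(2-)
proof (induction "card (S - H)" arbitrary: H p j z e rule: less_induct)
  case less
  have S: "S \<subseteq> pairs n" "linked S" using adm by (auto simp: admissible_def)
  have fin: "finite S" by (rule finite_edges[OF S(1)])
  have "e \<in> pairs n" using less.prems S by blast
  then obtain y where y: "ends e = {z, y}" "z \<noteq> y" "z < n" "y < n"
    using less.prems(4) by (rule ends_pairsE)
  have e: "e = edge z y" using edge_ends y \<open>e \<in> pairs n\<close> by simp
  let ?H = "insert e H"
  have decr: "card (S - ?H) < card (S - H)"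
    using fin less.prems by (intro psubset_card_mono) auto
  have step: "\<exists>p j z. reach p j S z"
    if "?H \<noteq> S" "reach p' j' ?H s" "e' \<in> S - ?H" "s \<in> ends e'" for p' j' s e'
    by (rule less.hyps[OF decr _ that(2-4)]) (use that less.prems in auto)
  show ?case
  proof (cases "y \<in> verts H \<union> {u, v}")
    case False
    then have r: "reach (Suc p) j ?H y"
      using reach.fresh[OF less.prems(2) y(4)] e by simp
    have "y \<in> verts S - {u, v}" using False y(1) less.prems(3) unfolding verts_def by blast
    then have "2 \<le> card (inc S y)" using adm by (simp add: admissible_def)
    moreover have "finite (inc S y)" using fin by (simp add: inc_def)
    ultimately have "\<not> inc S y \<subseteq> {e}"
      using card_mono[of "{e}" "inc S y"] by auto
    then obtain e' where e': "e' \<in> S" "y \<in> ends e'" "e' \<noteq> e"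
      unfolding inc_def by blast
    have "e' \<notin> H" using e' False unfolding verts_def by blast
    then show ?thesis
      using step[OF _ r, of e'] e' by blast
  next
    case True
    have r: "reach p (Suc j) ?H s" if "s \<in> verts H \<union> {u, v}" for s
      using reach.close[OF less.prems(2) True that] e less.prems by blast
    have z: "z \<in> verts H \<union> {u, v}" using reach_invariants[OF less.prems(2)] by blast
    show ?thesis
    proof (cases "?H = S")
      case True
      then show ?thesis using r[OF z] by auto
    next
      case False
      then have "?H \<subset> S" using less.prems by blast
      then obtain e' s where e': "e' \<in> S - ?H" "s \<in> ends e'" "s \<in> verts ?H \<union> {u, v}"
        using S(2) unfolding linked_def by blast
      have "s \<in> verts H \<union> {u, v}"
        using e'(3) y(1) z \<open>y \<in> verts H \<union> {u, v}\<close> by (auto simp: verts_insert)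
      then show ?thesis using step[OF False r e'(1,2)] by blast
    qed
  qed
qed

lemma admissible_reach:
  assumes "admissible S"
  shows "\<exists>p j z. reach p j S z"
proof -
  have "{} \<subset> S" "linked S" using assms by (auto simp: admissible_def)
  then have "\<exists>e\<in>S - {}. ends e \<inter> (verts {} \<union> {u, v}) \<noteq> {}"
    unfolding linked_def by blast
  then obtain e z where "e \<in> S - {}" "z \<in> ends e" "z \<in> {u, v}"
    unfolding verts_def by blast
  then show ?thesis
    using reach_cover[OF assms \<open>{} \<subset> S\<close> reach.start] by blast
qed

text \<open>Split by the last step into the images \<open>F\<close> (fresh) and \<open>K\<close>
  (close). A fresh step has at most \<open>n\<close> choices of \<open>w\<close>, a closing step at
  most \<open>(l + 2)\<^sup>2\<close> choices of \<open>t\<close> and \<open>s\<close>. The factors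
  2 in the two bases make each class at most half of the bound, so the two halves add up.\<close>

lemma card_reach_le:
  assumes "p + j \<le> l"
  shows "finite {(H, z). reach p j H z} \<and>
    real (card {(H, z). reach p j H z}) \<le> 2 * (2 * real n) ^ p * (2 * (real l + 2)\<^sup>2) ^ j"
  using assms
proof (induction "p + j" arbitrary: p j rule: less_induct)
  case less
  define R where "R = (\<lambda>p j. {(H, z). reach p j H z})"
  define bd where "bd = (\<lambda>p j. 2 * (2 * real n) ^ p * (2 * (real l + 2)\<^sup>2) ^ j)"
  define F where "F = (case p of 0 \<Rightarrow> {} | Suc p' \<Rightarrow>
      (\<lambda>((H, z), w). (insert (edge z w) H, w)) ` (R p' j \<times> {..<n}))"
  define K where "K = (case j of 0 \<Rightarrow> {} | Suc j' \<Rightarrow>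
      (\<lambda>((H, z), (t, s)). (insert (edge z t) H, s)) `
        (SIGMA q:R p j'. (verts (fst q) \<union> {u, v}) \<times> (verts (fst q) \<union> {u, v})))"
  define Z where "Z = (if p = 0 \<and> j = 0 then {({} :: (nat \<times> nat) set)} \<times> {u, v} else {})"
  have sub: "R p j \<subseteq> Z \<union> F \<union> K"
  proof
    fix q assume "q \<in> R p j"
    then obtain H z where q: "q = (H, z)" and "reach p j H z" by (auto simp: R_def)
    from this(2) show "q \<in> Z \<union> F \<union> K"
    proof cases
      case start
      then show ?thesis by (auto simp: q Z_def)
    next
      case (fresh p' H' z')
      then have "q = (\<lambda>((H, z), w). (insert (edge z w) H, w)) ((H', z'), z)"
        "((H', z'), z) \<in> R p' j \<times> {..<n}"
        by (simp_all add: q R_def)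
      then have "q \<in> F" unfolding F_def fresh(1) nat.case by (rule image_eqI)
      then show ?thesis by simp
    next
      case (close j' H' z' t)
      then have "q = (\<lambda>((H, z), (t, s)). (insert (edge z t) H, s)) ((H', z'), (t, z))"
        "((H', z'), (t, z)) \<in> (SIGMA q:R p j'. (verts (fst q) \<union> {u, v}) \<times> (verts (fst q) \<union> {u, v}))"
        by (simp_all add: q R_def) auto
      then have "q \<in> K" unfolding K_def close(1) nat.case by (rule image_eqI)
      then show ?thesis by simp
    qed
  qed
  have Z: "finite Z \<and> real (card Z) \<le> (if p = 0 \<and> j = 0 then 2 else 0)"
    using u_neq_v by (simp add: Z_def card_cartesian_product)
  have F: "finite F \<and> real (card F) \<le> (if p = 0 then 0 else bd p j / 2)"
  proof (cases p)
    case 0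
    then show ?thesis by (simp add: F_def)
  next
    case (Suc p')
    have IH: "finite (R p' j)" "real (card (R p' j)) \<le> bd p' j"
      using less.hyps[of p' j] less.prems Suc by (simp_all add: R_def bd_def)
    have "card F \<le> card (R p' j \<times> {..<n})"
      unfolding F_def Suc nat.case using IH by (intro card_image_le) auto
    then have "real (card F) \<le> real (card (R p' j)) * real n"
      by (simp add: card_cartesian_product flip: of_nat_mult)
    also have "\<dots> \<le> bd p' j * real n"
      using IH by (intro mult_right_mono) auto
    also have "\<dots> = bd p j / 2" by (simp add: bd_def Suc)
    finally show ?thesis using IH by (simp add: F_def Suc)
  qed
  have K: "finite K \<and> real (card K) \<le> (if j = 0 then 0 else bd p j / 2)"
  proof (cases j)
    case 0
    then show ?thesis by (simp add: K_def)
  next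
    case (Suc j')
    have IH: "finite (R p j')" "real (card (R p j')) \<le> bd p j'"
      using less.hyps[of p j'] less.prems Suc by (simp_all add: R_def bd_def)
    let ?V = "\<lambda>q :: (nat \<times> nat) set \<times> nat. verts (fst q) \<union> {u, v}"
    have V: "finite (?V q) \<and> card (?V q) \<le> l + 2" if "q \<in> R p j'" for q
      using that reach_invariants[of p j' "fst q" "snd q"] finite_verts[of "fst q"] less.prems
      by (auto simp: R_def vcount_def)
    then have finS: "finite (SIGMA q:R p j'. ?V q \<times> ?V q)"
      using IH(1) by (intro finite_SigmaI) auto
    then have "card K \<le> card (SIGMA q:R p j'. ?V q \<times> ?V q)"
      unfolding K_def Suc nat.case by (rule card_image_le)
    also have "\<dots> = (\<Sum>q\<in>R p j'. card (?V q \<times> ?V q))"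
      using IH(1) V by (intro card_SigmaI) blast+
    also have "\<dots> = (\<Sum>q\<in>R p j'. card (?V q) * card (?V q))"
      by (simp only: card_cartesian_product)
    also have "\<dots> \<le> (\<Sum>q\<in>R p j'. (l + 2) * (l + 2))"
      using V by (intro sum_mono mult_mono) auto
    finally have "real (card K) \<le> real (card (R p j') * ((l + 2) * (l + 2)))"
      by (simp only: of_nat_le_iff sum_constant of_nat_id)
    also have "\<dots> = real (card (R p j')) * (real l + 2)\<^sup>2"
      by (simp add: power2_eq_square algebra_simps)
    also have "\<dots> \<le> bd p j' * (real l + 2)\<^sup>2"
      using IH by (intro mult_right_mono) auto
    also have "\<dots> = bd p j / 2" by (simp add: bd_def Suc)
    finally have "real (card K) \<le> bd p j / 2" .
    moreover have "finite K" unfolding K_def Suc nat.case using finS by (rule finite_imageI)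
    ultimately show ?thesis using Suc by simp
  qed
  have fin: "finite (Z \<union> F \<union> K)" using Z F K by simp
  have "card (R p j) \<le> card (Z \<union> F \<union> K)" by (rule card_mono[OF fin sub])
  also have "\<dots> \<le> card Z + card F + card K"
    using card_Un_le[of "Z \<union> F" K] card_Un_le[of Z F] by linarith
  finally have "real (card (R p j)) \<le> real (card Z) + real (card F) + real (card K)"
    by linarith
  also have "\<dots> \<le> bd p j"
  proof -
    have "bd p j \<ge> 0" by (simp add: bd_def)
    moreover have "p = 0 \<and> j = 0 \<Longrightarrow> bd p j = 2" by (simp add: bd_def)
    ultimately show ?thesis using Z F K by (auto split: if_splits)
  qed
  finally show ?case
    using finite_subset[OF sub fin] by (simp add: R_def bd_def)
qed

text \<open>Sets are grouped by (p, j), and count times weight becomes a product of two geometric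
  terms. The hypothesis on \<open>L\<close> makes the ratio in p at most 1/2, and
  \<open>\<rho>\<close> is the ratio in j. The sum over p is at most 2, and the sum over j, which
  starts at 1, is at most \<open>2 * \<rho>\<close>; with the prefactor 8 this gives 32.\<close>

lemma sum_kap_sq_le:
  assumes L: "0 \<le> L" "16 * real n * L \<le> (real k)\<^sup>2"
    and \<rho>: "\<rho> = 2 * (real l + 2)\<^sup>2 * L * (4 * real l + 4) ^ 12" "\<rho> \<le> 1 / 2"
  shows "(\<Sum>S\<in>{S. S \<subseteq> pairs n \<and> card S \<le> l}. L ^ card S * (kap S)\<^sup>2) \<le> 32 * \<rho> / (real k)\<^sup>2"
proof -
  define D :: real where "D = 4 * real l + 4"
  let ?all = "{S. S \<subseteq> pairs n \<and> card S \<le> l}"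
  let ?idx = "{..l} \<times> {1..l}"
  define R where "R = (\<lambda>q :: nat \<times> nat. fst ` {(H, z). reach (fst q) (snd q) H z})"
  define wt where "wt = (\<lambda>q :: nat \<times> nat. L ^ (fst q + snd q) * ((2 / real k) ^ (fst q + 1) * D ^ (6 * snd q))\<^sup>2)"
  have finall: "finite ?all" using finite_pairs by (auto intro: finite_subset[of _ "Pow (pairs n)"])
  have wt0: "wt q \<ge> 0" for q using L by (simp add: wt_def)
  have D1: "D \<ge> 1" by (simp add: D_def)
  have pt: "\<exists>q\<in>?idx. S \<in> R q \<and> L ^ card S * (kap S)\<^sup>2 \<le> wt q"
    if S: "S \<subseteq> pairs n" "card S \<le> l" and ne: "kap S \<noteq> 0" for S
  proof -
    have adm: "admissible S" by (rule kap_nonzero[OF S(1) ne])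
    obtain p j z where r: "reach p j S z" using admissible_reach[OF adm] by blast
    have inv: "card S = p + j" "vcount S = p + 2" "finite S" using reach_invariants[OF r] by auto
    have b: "card (branch_edges S) \<le> 6 * j" using branch_edges_vcount[OF adm] inv by simp
    have "finite (branch_edges S)" using inv by (simp add: branch_edges_def)
    then have "card (branch_edges S) > 0"
      using branch_edges_nonempty[OF adm] by (simp add: card_gt_0_iff)
    \<comment> \<open>With \<open>j = 0\<close> there would be no branching edge, yet linkedness
      forces one at \<open>u\<close> or \<open>v\<close>.\<close>
    then have j: "j \<ge> 1" using b by linarith
    have "\<bar>kap S\<bar> \<le> (2 / real k) ^ (p + 1) * D ^ card (branch_edges S)"
      using abs_kap_le[OF S] inv by (simp add: D_def)
    also have "\<dots> \<le> (2 / real k) ^ (p + 1) * D ^ (6 * j)"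
      using D1 b by (intro mult_left_mono power_increasing) auto
    finally have "\<bar>kap S\<bar> \<le> (2 / real k) ^ (p + 1) * D ^ (6 * j)" .
    then have "\<bar>kap S\<bar>\<^sup>2 \<le> ((2 / real k) ^ (p + 1) * D ^ (6 * j))\<^sup>2"
      by (intro power_mono) auto
    then have "L ^ card S * (kap S)\<^sup>2 \<le> wt (p, j)"
      unfolding wt_def fst_conv snd_conv inv(1) using L by (intro mult_left_mono) auto
    moreover have "S \<in> R (p, j)" using r unfolding R_def by force
    moreover have "(p, j) \<in> ?idx" using inv j S by auto
    ultimately show ?thesis by blast
  qed
  have "(\<Sum>S\<in>?all. L ^ card S * (kap S)\<^sup>2) \<le> (\<Sum>S\<in>?all. \<Sum>q\<in>?idx. if S \<in> R q then wt q else 0)"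
  proof (rule sum_mono)
    fix S assume S: "S \<in> ?all"
    have nn: "(\<Sum>q\<in>?idx. if S \<in> R q then wt q else 0) \<ge> 0"
      using wt0 by (intro sum_nonneg) auto
    show "L ^ card S * (kap S)\<^sup>2 \<le> (\<Sum>q\<in>?idx. if S \<in> R q then wt q else 0)"
    proof (cases "kap S = 0")
      case True
      then show ?thesis using nn by simp
    next
      case False
      then obtain q where q: "q \<in> ?idx" "S \<in> R q" "L ^ card S * (kap S)\<^sup>2 \<le> wt q"
        using pt S by blast
      have "(if S \<in> R q then wt q else 0) \<le> (\<Sum>q\<in>?idx. if S \<in> R q then wt q else 0)"
        using q(1) wt0 by (intro member_le_sum) auto
      then show ?thesis using q by simp
    qed
  qed
  also have "\<dots> = (\<Sum>q\<in>?idx. \<Sum>S\<in>?all. if S \<in> R q then wt q else 0)"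
    by (rule sum.swap)
  also have "\<dots> \<le> (\<Sum>q\<in>?idx. (8 / (real k)\<^sup>2) * ((1 / 2) ^ fst q * \<rho> ^ snd q))"
  proof (rule sum_mono)
    fix q assume q: "q \<in> ?idx"
    obtain p j where pj: "q = (p, j)" by (cases q)
    have "(\<Sum>S\<in>?all. if S \<in> R q then wt q else 0) = real (card (?all \<inter> R q)) * wt q"
      using finall by (simp add: sum.If_cases)
    also have "\<dots> \<le> (8 / (real k)\<^sup>2) * ((1 / 2) ^ p * \<rho> ^ j)"
    proof (cases "?all \<inter> R q = {}")
      case True
      moreover have "\<rho> \<ge> 0" using \<rho>(1) L by simp
      ultimately show ?thesis by simp
    next
      case False
      then obtain S z where S: "card S \<le> l" "reach p j S z" by (auto simp: R_def pj)
      then have "p + j \<le> l" using reach_invariants by fastforce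
      then have cr: "finite {(H, z). reach p j H z}"
        "real (card {(H, z). reach p j H z}) \<le> 2 * (2 * real n) ^ p * (2 * (real l + 2)\<^sup>2) ^ j"
        using card_reach_le by auto
      have "card (?all \<inter> R q) \<le> card (R q)"
        using cr(1) by (intro card_mono) (auto simp: R_def pj)
      also have "\<dots> \<le> card {(H, z). reach p j H z}"
        unfolding R_def pj fst_conv snd_conv using cr(1) by (rule card_image_le)
      finally have "real (card (?all \<inter> R q)) \<le> 2 * (2 * real n) ^ p * (2 * (real l + 2)\<^sup>2) ^ j"
        using cr(2) by linarith
      then have "real (card (?all \<inter> R q)) * wt q \<le> 2 * (2 * real n) ^ p * (2 * (real l + 2)\<^sup>2) ^ j * wt q"
        using wt0 by (rule mult_right_mono)
      \<comment> \<open>The exponent 12 in \<open>\<rho>\<close> comes from squaring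
        \<open>D ^ (6 * j)\<close>, and the spare factor \<open>(2 / real k)\<^sup>2\<close>, times
        the leading 2 of the count, becomes the prefactor.\<close>
      also have "\<dots> = (8 / (real k)\<^sup>2) * ((2 * real n * L * (2 / real k)\<^sup>2) ^ p * \<rho> ^ j)"
      proof -
        have "2 * A ^ p * B ^ j * (L ^ (p + j) * (a ^ (p + 1) * D ^ (6 * j))\<^sup>2)
            = 2 * a\<^sup>2 * ((A * L * a\<^sup>2) ^ p * (B * L * D ^ 12) ^ j)" for A B a :: real
          by (simp add: power_add power_mult_distrib power_mult[symmetric] mult_ac)
        moreover have "8 / (real k)\<^sup>2 = 2 * (2 / real k)\<^sup>2" by (simp add: power_divide)
        ultimately show ?thesis
          by (simp only: wt_def \<rho>(1) D_def[symmetric] pj fst_conv snd_conv)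
      qed
      also have "\<dots> \<le> (8 / (real k)\<^sup>2) * ((1 / 2) ^ p * \<rho> ^ j)"
      proof -
        have "2 * real n * L * (2 / real k)\<^sup>2 \<le> 1 / 2"
          using L(2) k_pos by (simp add: field_simps)
        moreover have "\<rho> \<ge> 0" using \<rho>(1) L by simp
        ultimately show ?thesis
          using L by (intro mult_left_mono mult_right_mono power_mono) auto
      qed
      finally show ?thesis .
    qed
    finally show "(\<Sum>S\<in>?all. if S \<in> R q then wt q else 0) \<le> (8 / (real k)\<^sup>2) * ((1 / 2) ^ fst q * \<rho> ^ snd q)"
      by (simp add: pj)
  qed
  also have "\<dots> = (8 / (real k)\<^sup>2) * (\<Sum>q\<in>?idx. (1 / 2) ^ fst q * \<rho> ^ snd q)"
    by (rule sum_distrib_left[symmetric])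
  also have "(\<Sum>q\<in>?idx. (1 / 2) ^ fst q * \<rho> ^ snd q) = (\<Sum>p\<le>l. (1 / 2) ^ p) * (\<Sum>j=1..l. \<rho> ^ j)"
    by (simp only: sum_product sum.cartesian_product case_prod_unfold)
  also have "(8 / (real k)\<^sup>2) * ((\<Sum>p\<le>l. (1 / 2) ^ p) * (\<Sum>j=1..l. \<rho> ^ j)) \<le> (8 / (real k)\<^sup>2) * (2 * (2 * \<rho>))"
  proof -
    have \<rho>0: "\<rho> \<ge> 0" using \<rho>(1) L by simp
    have "(\<Sum>p\<le>l. (1 / 2 :: real) ^ p) \<le> 2"
      by (simp add: sum_gp_basic sum_gp0)
    moreover have "(\<Sum>j=1..l. \<rho> ^ j) \<le> 2 * \<rho>"
    proof -
      have "(\<Sum>j=1..l. \<rho> ^ j) \<le> (\<Sum>j=1..l. \<rho> * (1 / 2) ^ (j - 1))"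
      proof (rule sum_mono)
        fix j assume "j \<in> {1..l}"
        then obtain i where "j = Suc i" by (cases j) auto
        then show "\<rho> ^ j \<le> \<rho> * (1 / 2) ^ (j - 1)"
          using \<rho>0 \<rho>(2) by (simp add: mult_left_mono power_mono)
      qed
      also have "\<dots> = \<rho> * (\<Sum>i<l. (1 / 2) ^ i)"
        unfolding sum_distrib_left[symmetric]
        by (rule arg_cong[where f = "(*) \<rho>"], rule sum.reindex_bij_witness[where i = Suc and j = "\<lambda>j. j - 1"]) auto
      also have "\<dots> \<le> \<rho> * 2"
        using \<rho>0 by (intro mult_left_mono) (simp add: sum_gp_strict)
      finally show ?thesis by (simp add: mult.commute)
    qed
    ultimately have "(\<Sum>p\<le>l. (1 / 2 :: real) ^ p) * (\<Sum>j=1..l. \<rho> ^ j) \<le> 2 * (2 * \<rho>)"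
      using \<rho>0 by (intro mult_mono sum_nonneg) auto
    then show ?thesis by (rule mult_left_mono) simp
  qed
  finally show ?thesis by simp
qed

end

section \<open>The dual certificate\<close>

text \<open>This is independence of the edges: expanding the product of sums on the right over the
  set of edges that are present gives the sum over \<open>E\<close>.\<close>

lemma sum_Bernoulli_prod:
  fixes t :: "'a \<Rightarrow> real" and \<phi> :: "'a \<Rightarrow> bool \<Rightarrow> real"
  assumes "finite P"
  shows "(\<Sum>E\<in>Pow P. (\<Prod>e\<in>P. if e \<in> E then t e else 1 - t e) * (\<Prod>e\<in>P. \<phi> e (e \<in> E)))
    = (\<Prod>e\<in>P. t e * \<phi> e True + (1 - t e) * \<phi> e False)"
proof -
  have "(\<Prod>e\<in>P. if e \<in> E then t e else 1 - t e) * (\<Prod>e\<in>P. \<phi> e (e \<in> E))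
      = (\<Prod>e\<in>E. t e * \<phi> e True) * (\<Prod>e\<in>P - E. (1 - t e) * \<phi> e False)" if "E \<in> Pow P" for E
  proof -
    have "(\<Prod>e\<in>P. if e \<in> E then t e else 1 - t e) * (\<Prod>e\<in>P. \<phi> e (e \<in> E))
        = (\<Prod>e\<in>P. if e \<in> E then t e * \<phi> e True else (1 - t e) * \<phi> e False)"
      unfolding prod.distrib[symmetric] by (rule prod.cong) auto
    moreover have "P \<inter> {e. e \<in> E} = E" "P \<inter> - {e. e \<in> E} = P - E" using that by auto
    ultimately show ?thesis
      using assms by (simp add: prod.If_cases)
  qed
  then show ?thesis
    using prod_add[OF assms, of "\<lambda>e. t e * \<phi> e True" "\<lambda>e. (1 - t e) * \<phi> e False"] by simp
qed

lemma sum_Bernoulli_prod2: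
  fixes t :: "'a \<Rightarrow> real" and a b :: "'a \<Rightarrow> bool \<Rightarrow> real"
  assumes "finite P" "S \<subseteq> P" "T \<subseteq> P"
  shows "(\<Sum>E\<in>Pow P. (\<Prod>e\<in>P. if e \<in> E then t e else 1 - t e)
        * ((\<Prod>e\<in>S. a e (e \<in> E)) * (\<Prod>e\<in>T. b e (e \<in> E))))
    = (\<Prod>e\<in>P. t e * ((if e \<in> S then a e True else 1) * (if e \<in> T then b e True else 1))
        + (1 - t e) * ((if e \<in> S then a e False else 1) * (if e \<in> T then b e False else 1)))"
proof -
  have ext: "(\<Prod>e\<in>S. f e) = (\<Prod>e\<in>P. if e \<in> S then f e else 1)" if "S \<subseteq> P" for S and f :: "'a \<Rightarrow> real"
    using assms(1) that prod.inter_restrict[of P f S] by (simp add: Int_absorb1)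
  show ?thesis
    unfolding ext[OF assms(2)] ext[OF assms(3)] prod.distrib[of "\<lambda>e. if e \<in> S then _ e else 1", symmetric]
    by (rule sum_Bernoulli_prod[OF assms(1), where \<phi> =
          "\<lambda>e c. (if e \<in> S then a e c else 1) * (if e \<in> T then b e c else 1)"])
qed

definition centred_mono :: "real \<Rightarrow> 'a set \<Rightarrow> 'a set \<Rightarrow> real" where
  "centred_mono q S E = (\<Prod>e\<in>S. of_bool (e \<in> E) - q)"

text \<open>Each factor has mean 0 under a Bernoulli variable with parameter \<open>t e\<close>, and
  expectation 1 against \<open>Y - a\<close> for every constant \<open>a\<close>.\<close>

definition dual_mono :: "('a \<Rightarrow> real) \<Rightarrow> 'a set \<Rightarrow> 'a set \<Rightarrow> real" where
  "dual_mono t T E = (\<Prod>e\<in>T. (of_bool (e \<in> E) - t e) / (t e * (1 - t e)))"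

text \<open>The expectation factors over edges: an edge of both sets gives 1, an edge of
  \<open>T\<close> alone 0, an edge of \<open>S\<close> alone \<open>t e - q\<close>, any other edge
  1.\<close>

lemma sum_Bernoulli_centred_dual:
  fixes t :: "'a \<Rightarrow> real"
  assumes "finite P" "S \<subseteq> P" "T \<subseteq> P" "\<And>e. e \<in> P \<Longrightarrow> 0 < t e \<and> t e < 1"
  shows "(\<Sum>E\<in>Pow P. (\<Prod>e\<in>P. if e \<in> E then t e else 1 - t e) * (centred_mono q S E * dual_mono t T E))
    = (if T \<subseteq> S then (\<Prod>e\<in>S - T. t e - q) else 0)"
proof -
  let ?a = "\<lambda>(e :: 'a) c. of_bool c - q" and ?b = "\<lambda>e c. (of_bool c - t e) / (t e * (1 - t e))"
  let ?val = "\<lambda>e. t e * ((if e \<in> S then ?a e True else 1) * (if e \<in> T then ?b e True else 1))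
        + (1 - t e) * ((if e \<in> S then ?a e False else 1) * (if e \<in> T then ?b e False else 1))"
  have val: "?val e = (if e \<in> T then (if e \<in> S then 1 else 0) else if e \<in> S then t e - q else 1)"
    if "e \<in> P" for e
  proof -
    have t: "t e \<noteq> 0" "1 - t e \<noteq> 0" using assms(4)[OF that] by auto
    have b: "?b e True = 1 / t e" "?b e False = - (1 / (1 - t e))" using t by simp_all
    show ?thesis unfolding b using t by (cases "e \<in> T") (simp, simp add: algebra_simps)
  qed
  have "(\<Sum>E\<in>Pow P. (\<Prod>e\<in>P. if e \<in> E then t e else 1 - t e) * (centred_mono q S E * dual_mono t T E))
      = (\<Prod>e\<in>P. ?val e)"
    unfolding centred_mono_def dual_mono_def
    by (rule sum_Bernoulli_prod2[OF assms(1-3), where a = ?a and b = ?b])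
  also have "\<dots> = (\<Prod>e\<in>P. if e \<in> T then (if e \<in> S then 1 else 0) else if e \<in> S then t e - q else 1)"
    by (rule prod.cong[OF refl val])
  also have "\<dots> = (if T \<subseteq> S then (\<Prod>e\<in>S - T. t e - q) else 0)"
  proof (cases "T \<subseteq> S")
    case True
    have "(\<Prod>e\<in>S - T. t e - q) = (\<Prod>e\<in>P. if e \<in> S - T then t e - q else 1)"
      using assms(1,2) prod.inter_restrict[of P "\<lambda>e. t e - q" "S - T"]
      by (simp add: Int_absorb1 subset_iff)
    also have "\<dots> = (\<Prod>e\<in>P. if e \<in> T then (if e \<in> S then 1 else 0) else if e \<in> S then t e - q else 1)"
      using True by (intro prod.cong) auto
    finally show ?thesis using True by simp
  next
    case False
    then obtain e where "e \<in> T" "e \<notin> S" by blast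
    then show ?thesis
      using False assms(1,3) by auto
  qed
  finally show ?thesis .
qed

lemma sum_Bernoulli_dual_dual:
  fixes t :: "'a \<Rightarrow> real"
  assumes "finite P" "S \<subseteq> P" "T \<subseteq> P" "\<And>e. e \<in> P \<Longrightarrow> 0 < t e \<and> t e < 1"
  shows "(\<Sum>E\<in>Pow P. (\<Prod>e\<in>P. if e \<in> E then t e else 1 - t e) * (dual_mono t S E * dual_mono t T E))
    = (if S = T then (\<Prod>e\<in>S. 1 / (t e * (1 - t e))) else 0)"
proof -
  let ?b = "\<lambda>e c. (of_bool c - t e) / (t e * (1 - t e))"
  let ?val = "\<lambda>e. t e * ((if e \<in> S then ?b e True else 1) * (if e \<in> T then ?b e True else 1))
        + (1 - t e) * ((if e \<in> S then ?b e False else 1) * (if e \<in> T then ?b e False else 1))"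
  let ?res = "\<lambda>e. if e \<in> S then (if e \<in> T then 1 / (t e * (1 - t e)) else 0) else if e \<in> T then 0 else 1"
  have val: "?val e = ?res e" if "e \<in> P" for e
  proof -
    have t: "t e \<noteq> 0" "1 - t e \<noteq> 0" using assms(4)[OF that] by auto
    have b: "?b e True = 1 / t e" "?b e False = - (1 / (1 - t e))" using t by simp_all
    have "1 / t e + 1 / (1 - t e) = 1 / (t e * (1 - t e))" using t by (simp add: field_simps)
    then show ?thesis unfolding b using t by simp
  qed
  have "(\<Sum>E\<in>Pow P. (\<Prod>e\<in>P. if e \<in> E then t e else 1 - t e) * (dual_mono t S E * dual_mono t T E))
      = (\<Prod>e\<in>P. ?val e)"
    unfolding dual_mono_def
    by (rule sum_Bernoulli_prod2[OF assms(1-3), where a = ?b and b = ?b])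
  also have "\<dots> = (\<Prod>e\<in>P. ?res e)"
    by (rule prod.cong[OF refl val])
  also have "\<dots> = (if S = T then (\<Prod>e\<in>S. 1 / (t e * (1 - t e))) else 0)"
  proof (cases "S = T")
    case True
    have "(\<Prod>e\<in>S. 1 / (t e * (1 - t e))) = (\<Prod>e\<in>P. if e \<in> S then 1 / (t e * (1 - t e)) else 1)"
      using assms(1,2) prod.inter_restrict[of P "\<lambda>e. 1 / (t e * (1 - t e))" S]
      by (simp add: Int_absorb1)
    also have "\<dots> = (\<Prod>e\<in>P. ?res e)"
      using True by (intro prod.cong) auto
    finally show ?thesis using True by simp
  next
    case False
    then obtain e where "e \<in> S \<and> e \<notin> T \<or> e \<in> T \<and> e \<notin> S" by blast
    then have "e \<in> P" "?res e = 0" using assms(2,3) by auto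
    then have "(\<Prod>e\<in>P. ?res e) = 0"
      by (intro prod_zero[OF assms(1)] bexI[of _ e])
    then show ?thesis using False by (simp only: if_False)
  qed
  finally show ?thesis .
qed

section \<open>Joint expectation over labels and graph\<close>

definition ssbm_exp :: "nat \<Rightarrow> real \<Rightarrow> real \<Rightarrow> nat \<Rightarrow> ((nat \<Rightarrow> nat) \<Rightarrow> (nat \<times> nat) set \<Rightarrow> real) \<Rightarrow> real" where
  "ssbm_exp n q \<epsilon> k G = avg n k (\<lambda>x. \<Sum>E\<in>Pow (pairs n). graph_prob n q \<epsilon> k x E * G x E)"

lemma ssbm_exp_add:
  "ssbm_exp n q \<epsilon> k (\<lambda>x E. F x E + G x E) = ssbm_exp n q \<epsilon> k F + ssbm_exp n q \<epsilon> k G"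
  by (simp add: ssbm_exp_def distrib_left sum.distrib avg_add)

lemma ssbm_exp_diff:
  "ssbm_exp n q \<epsilon> k (\<lambda>x E. F x E - G x E) = ssbm_exp n q \<epsilon> k F - ssbm_exp n q \<epsilon> k G"
  by (simp add: ssbm_exp_def right_diff_distrib sum_subtractf avg_diff)

lemma ssbm_exp_cmult:
  "ssbm_exp n q \<epsilon> k (\<lambda>x E. a * G x E) = a * ssbm_exp n q \<epsilon> k G"
  by (simp add: ssbm_exp_def sum_distrib_left mult.left_commute avg_cmult flip: avg_cmult)

lemma ssbm_exp_sum:
  "ssbm_exp n q \<epsilon> k (\<lambda>x E. \<Sum>i\<in>I. G i x E) = (\<Sum>i\<in>I. ssbm_exp n q \<epsilon> k (G i))"
  unfolding ssbm_exp_def sum_distrib_left by (subst sum.swap) (rule avg_sum)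

lemma ssbm_exp_cong:
  assumes "\<And>x E. x \<in> PiE {..<n} (\<lambda>_. {..<k}) \<Longrightarrow> E \<subseteq> pairs n \<Longrightarrow> F x E = G x E"
  shows "ssbm_exp n q \<epsilon> k F = ssbm_exp n q \<epsilon> k G"
  unfolding ssbm_exp_def using assms by (intro avg_cong sum.cong) auto

lemma ssbm_theta_eq:
  "k > 0 \<Longrightarrow> ssbm_theta q \<epsilon> k x i j = q + q * \<epsilon> * cent k x (i, j)"
  by (auto simp: ssbm_theta_def cent_def field_simps)

lemma ssbm_risk_eq:
  "ssbm_risk n q \<epsilon> k f = (\<Sum>i<n. \<Sum>j<n. ssbm_exp n q \<epsilon> k (\<lambda>x E. (f (adj E) i j - ssbm_theta q \<epsilon> k x i j)\<^sup>2))"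
proof -
  have "ssbm_risk n q \<epsilon> k f
      = ssbm_exp n q \<epsilon> k (\<lambda>x E. frob_sq n (\<lambda>i j. f (adj E) i j - ssbm_theta q \<epsilon> k x i j))"
    by (simp add: ssbm_risk_def ssbm_exp_def avg_def sum_divide_distrib)
  then show ?thesis
    by (simp add: frob_sq_def ssbm_exp_sum)
qed

section \<open>The certificate, its orthogonality and its norm\<close>

locale ssbm_model = ssbm_pair +
  fixes q \<epsilon> :: real and l :: nat
  assumes q: "0 < q" "q \<le> 1 / 2" and eps: "0 < \<epsilon>" "\<epsilon> \<le> 1 / 2"
begin

abbreviation EE :: "((nat \<Rightarrow> nat) \<Rightarrow> (nat \<times> nat) set \<Rightarrow> real) \<Rightarrow> real" where
  "EE \<equiv> ssbm_exp n q \<epsilon> k"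

definition th :: "(nat \<Rightarrow> nat) \<Rightarrow> nat \<times> nat \<Rightarrow> real" where
  "th x e = q + q * \<epsilon> * cent k x e"

lemma graph_prob_th:
  "graph_prob n q \<epsilon> k x E = (\<Prod>e\<in>pairs n. if e \<in> E then th x e else 1 - th x e)"
  unfolding graph_prob_def th_def ssbm_theta_eq[OF k_pos] prod.collapse ..

text \<open>Keeping the edge probabilities away from 0 and 1 makes the dual products well defined
  and gives variance at least q/8, the origin of the 8 in
  \<open>8 * q * \<epsilon>\<^sup>2\<close>.\<close>

lemma th_bounds: "q / 2 \<le> th x e" "th x e \<le> 3 / 4"
proof -
  have "\<bar>\<epsilon> * cent k x e\<bar> \<le> 1 / 2 * 1"
    unfolding abs_mult using eps abs_cent_le[OF k_pos] by (intro mult_mono) auto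
  then have "q * \<bar>\<epsilon> * cent k x e\<bar> \<le> q * (1 / 2)"
    using q by (intro mult_left_mono) auto
  then have "\<bar>q * \<epsilon> * cent k x e\<bar> \<le> q / 2"
    using q by (simp add: abs_mult mult.assoc)
  then show "q / 2 \<le> th x e" "th x e \<le> 3 / 4"
    unfolding th_def using q by linarith+
qed

lemma th_pos: "0 < th x e \<and> th x e < 1"
  using th_bounds[of x e] q by linarith

lemma th_var: "q / 8 \<le> th x e * (1 - th x e)"
proof -
  have "q / 2 * (1 / 4) \<le> th x e * (1 - th x e)"
    using th_bounds[of x e] q by (intro mult_mono) auto
  then show ?thesis by simp
qed

lemma EE_nonneg:
  assumes "\<And>x E. 0 \<le> G x E"
  shows "0 \<le> EE G"
proof -
  have "graph_prob n q \<epsilon> k x E \<ge> 0" for x E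
    unfolding graph_prob_th by (intro prod_nonneg) (use th_pos in \<open>auto simp: less_imp_le\<close>)
  then show ?thesis
    unfolding ssbm_exp_def avg_def using assms
    by (intro divide_nonneg_nonneg sum_nonneg mult_nonneg_nonneg) auto
qed

definition lowdeg :: "(nat \<times> nat) set set" where
  "lowdeg = {S. S \<subseteq> pairs n \<and> card S \<le> l}"

text \<open>It may depend on the labels, through \<open>th x\<close>, since it is a witness for the
  lower bound and not an estimator.\<close>

definition certificate :: "(nat \<Rightarrow> nat) \<Rightarrow> (nat \<times> nat) set \<Rightarrow> real" where
  "certificate x E = (\<Sum>T\<in>lowdeg. ((q * \<epsilon>) ^ card T * kap T) * dual_mono (th x) T E)"

lemma finite_lowdeg: "finite lowdeg"
  unfolding lowdeg_def using finite_pairs by (auto intro: finite_subset[of _ "Pow (pairs n)"])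

lemma prod_th_minus: "(\<Prod>e\<in>S. th x e - q) = (q * \<epsilon>) ^ card S * cprod k S x"
  by (simp add: th_def cprod_def prod.distrib)

text \<open>Given the labels, the edges of \<open>S - T\<close> leave the factors
  \<open>th x e - q\<close>, which are \<open>q * \<epsilon>\<close> times the centred indicators.
  The function \<open>g\<close> is used as 1 and as the indicator of uv.\<close>

lemma EE_centred_dual:
  assumes "S \<subseteq> pairs n" "T \<subseteq> pairs n"
  shows "EE (\<lambda>x E. g x * (centred_mono q S E * dual_mono (th x) T E))
    = (if T \<subseteq> S then (q * \<epsilon>) ^ card (S - T) * avg n k (\<lambda>x. g x * cprod k (S - T) x) else 0)"
proof -
  have "(\<Sum>E\<in>Pow (pairs n). graph_prob n q \<epsilon> k x E * (g x * (centred_mono q S E * dual_mono (th x) T E)))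
      = g x * (if T \<subseteq> S then (q * \<epsilon>) ^ card (S - T) * cprod k (S - T) x else 0)" for x
    unfolding graph_prob_th
    using sum_Bernoulli_centred_dual[OF finite_pairs assms, of "th x" q] th_pos
    by (simp add: mult.left_commute[of _ "g x"] prod_th_minus flip: sum_distrib_left)
  then show ?thesis
    unfolding ssbm_exp_def
    by (simp add: avg_const[OF k_pos] mult.left_commute[of _ "(q * \<epsilon>) ^ card (S - T)"] avg_cmult)
qed

text \<open>The powers of \<open>q * \<epsilon>\<close> for \<open>T\<close> and for
  \<open>S - T\<close> combine to one that does not depend on \<open>T\<close>; what remains is the
  defining system of the cumulants, \<open>sum_kap\<close>.\<close>

lemma EE_centred_certificate:
  assumes "S \<in> lowdeg"
  shows "EE (\<lambda>x E. centred_mono q S E * (certificate x E - cent k x (u, v))) = 0"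
proof -
  have S: "S \<subseteq> pairs n" "card S \<le> l" using assms by (auto simp: lowdeg_def)
  have fin: "finite S" by (rule finite_edges[OF S(1)])
  have "EE (\<lambda>x E. centred_mono q S E * certificate x E)
      = EE (\<lambda>x E. \<Sum>T\<in>lowdeg. ((q * \<epsilon>) ^ card T * kap T) * (centred_mono q S E * dual_mono (th x) T E))"
    unfolding certificate_def sum_distrib_left by (simp add: mult_ac)
  also have "\<dots> = (\<Sum>T\<in>lowdeg. ((q * \<epsilon>) ^ card T * kap T)
      * (if T \<subseteq> S then (q * \<epsilon>) ^ card (S - T) * avg n k (\<lambda>x. 1 * cprod k (S - T) x) else 0))"
    unfolding ssbm_exp_sum ssbm_exp_cmult
  proof (rule sum.cong[OF refl])
    fix T assume "T \<in> lowdeg"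
    then have "T \<subseteq> pairs n" by (simp add: lowdeg_def)
    from EE_centred_dual[OF S(1) this, of "\<lambda>_. 1"]
    show "((q * \<epsilon>) ^ card T * kap T) * EE (\<lambda>x E. centred_mono q S E * dual_mono (th x) T E)
      = ((q * \<epsilon>) ^ card T * kap T)
      * (if T \<subseteq> S then (q * \<epsilon>) ^ card (S - T) * avg n k (\<lambda>x. 1 * cprod k (S - T) x) else 0)"
      by simp
  qed
  also have "\<dots> = (\<Sum>T\<in>Pow S. ((q * \<epsilon>) ^ card T * kap T)
      * (if T \<subseteq> S then (q * \<epsilon>) ^ card (S - T) * avg n k (\<lambda>x. 1 * cprod k (S - T) x) else 0))"
  proof (rule sum.mono_neutral_right[OF finite_lowdeg])
    show "Pow S \<subseteq> lowdeg"
    proof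
      fix T assume "T \<in> Pow S"
      then show "T \<in> lowdeg" using S card_mono[OF fin, of T] by (simp add: lowdeg_def)
    qed
  qed auto
  also have "\<dots> = (\<Sum>T\<in>Pow S. (q * \<epsilon>) ^ card S * (kap T * avg n k (cprod k (S - T))))"
  proof (rule sum.cong[OF refl])
    fix T assume "T \<in> Pow S"
    then have "card S = card T + card (S - T)"
      using fin card_Un_disjoint[of T "S - T"] finite_subset[of T S] by (simp add: Un_absorb1)
    then show "((q * \<epsilon>) ^ card T * kap T)
      * (if T \<subseteq> S then (q * \<epsilon>) ^ card (S - T) * avg n k (\<lambda>x. 1 * cprod k (S - T) x) else 0)
      = (q * \<epsilon>) ^ card S * (kap T * avg n k (cprod k (S - T)))"
      using \<open>T \<in> Pow S\<close> by (simp add: power_add)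
  qed
  also have "\<dots> = (q * \<epsilon>) ^ card S * avg n k (\<lambda>x. cent k x (u, v) * cprod k S x)"
    using sum_kap[OF fin] by (simp flip: sum_distrib_left)
  \<comment> \<open>The case \<open>T = {}\<close>, where the dual product is 1, turns the moment
    back into an expectation over the graph.\<close>
  also have "\<dots> = EE (\<lambda>x E. cent k x (u, v) * (centred_mono q S E * dual_mono (th x) {} E))"
    using EE_centred_dual[OF S(1), of "{}"] by simp
  also have "\<dots> = EE (\<lambda>x E. centred_mono q S E * cent k x (u, v))"
    by (simp add: dual_mono_def mult.commute)
  finally show ?thesis
    by (simp add: right_diff_distrib ssbm_exp_diff)
qed

text \<open>Writing each edge variable as \<open>q\<close> plus its centred version expands the
  monomial over subsets of \<open>Q\<close>, all of which are again of low degree.\<close>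

lemma EE_mono_certificate:
  assumes "Q \<in> lowdeg"
  shows "EE (\<lambda>x E. of_bool (Q \<subseteq> E) * (certificate x E - cent k x (u, v))) = 0"
proof -
  have Q: "Q \<subseteq> pairs n" "card Q \<le> l" using assms by (auto simp: lowdeg_def)
  have fin: "finite Q" by (rule finite_edges[OF Q(1)])
  have expand: "of_bool (Q \<subseteq> E) = (\<Sum>S\<in>Pow Q. q ^ card (Q - S) * centred_mono q S E)" for E
  proof -
    have "(of_bool (Q \<subseteq> E) :: real) = (\<Prod>e\<in>Q. of_bool (e \<in> E))"
    proof (cases "Q \<subseteq> E")
      case True
      then have "(\<Prod>e\<in>Q. of_bool (e \<in> E) :: real) = 1" by (intro prod.neutral) auto
      then show ?thesis using True by simp
    next
      case False
      then obtain e where "e \<in> Q" "e \<notin> E" by blast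
      then show ?thesis using False fin by auto
    qed
    also have "\<dots> = (\<Prod>e\<in>Q. (of_bool (e \<in> E) - q) + q)" by simp
    also have "\<dots> = (\<Sum>S\<in>Pow Q. centred_mono q S E * q ^ card (Q - S))"
      unfolding centred_mono_def by (subst prod_add[OF fin]) simp
    finally show ?thesis by (simp add: mult.commute)
  qed
  have "EE (\<lambda>x E. of_bool (Q \<subseteq> E) * (certificate x E - cent k x (u, v)))
      = (\<Sum>S\<in>Pow Q. q ^ card (Q - S) * EE (\<lambda>x E. centred_mono q S E * (certificate x E - cent k x (u, v))))"
    unfolding expand sum_distrib_right mult.assoc ssbm_exp_sum ssbm_exp_cmult ..
  also have "\<dots> = 0"
  proof (intro sum.neutral ballI)
    fix S assume "S \<in> Pow Q"
    then have "S \<in> lowdeg"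
      using Q card_mono[OF fin, of S] unfolding lowdeg_def by auto
    then show "q ^ card (Q - S) * EE (\<lambda>x E. centred_mono q S E * (certificate x E - cent k x (u, v))) = 0"
      using EE_centred_certificate by simp
  qed
  finally show ?thesis .
qed

text \<open>For fixed labels distinct dual products are orthogonal, so only the diagonal remains,
  and each edge contributes at most \<open>(q * \<epsilon>)\<^sup>2 * (8 / q)\<close>.\<close>

lemma EE_certificate_sq:
  "EE (\<lambda>x E. (certificate x E)\<^sup>2) \<le> (\<Sum>T\<in>lowdeg. (8 * q * \<epsilon>\<^sup>2) ^ card T * (kap T)\<^sup>2)"
proof -
  define a where "a = (\<lambda>T. (q * \<epsilon>) ^ card T * kap T)"
  have "(\<Sum>E\<in>Pow (pairs n). graph_prob n q \<epsilon> k x E * (certificate x E)\<^sup>2)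
      \<le> (\<Sum>T\<in>lowdeg. (8 * q * \<epsilon>\<^sup>2) ^ card T * (kap T)\<^sup>2)" for x
  proof -
    have cert: "certificate x E = (\<Sum>T\<in>lowdeg. a T * dual_mono (th x) T E)" for E
      by (simp add: certificate_def a_def)
    have "(\<Sum>E\<in>Pow (pairs n). graph_prob n q \<epsilon> k x E * (certificate x E)\<^sup>2)
       = (\<Sum>E\<in>Pow (pairs n). \<Sum>S\<in>lowdeg. \<Sum>T\<in>lowdeg.
           a S * a T * (graph_prob n q \<epsilon> k x E * (dual_mono (th x) S E * dual_mono (th x) T E)))"
      unfolding cert power2_eq_square sum_product
      by (simp add: sum_distrib_left mult_ac)
    also have "\<dots> = (\<Sum>S\<in>lowdeg. \<Sum>E\<in>Pow (pairs n). \<Sum>T\<in>lowdeg.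
           a S * a T * (graph_prob n q \<epsilon> k x E * (dual_mono (th x) S E * dual_mono (th x) T E)))"
      by (rule sum.swap)
    also have "\<dots> = (\<Sum>S\<in>lowdeg. \<Sum>T\<in>lowdeg. \<Sum>E\<in>Pow (pairs n).
           a S * a T * (graph_prob n q \<epsilon> k x E * (dual_mono (th x) S E * dual_mono (th x) T E)))"
      by (rule sum.cong[OF refl sum.swap])
    also have "\<dots> = (\<Sum>S\<in>lowdeg. \<Sum>T\<in>lowdeg. a S * a T *
           (if S = T then (\<Prod>e\<in>S. 1 / (th x e * (1 - th x e))) else 0))"
      unfolding sum_distrib_left[symmetric] graph_prob_th
      by (intro sum.cong refl arg_cong2[where f = "(*)"] sum_Bernoulli_dual_dual finite_pairs th_pos)
        (auto simp: lowdeg_def)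
    also have "\<dots> = (\<Sum>S\<in>lowdeg. a S * a S * (\<Prod>e\<in>S. 1 / (th x e * (1 - th x e))))"
      using finite_lowdeg by (simp add: if_distrib[of "\<lambda>y. _ * y"] cong: if_cong)
    also have "\<dots> \<le> (\<Sum>S\<in>lowdeg. a S * a S * (\<Prod>e\<in>S. 8 / q))"
    proof (intro sum_mono mult_left_mono prod_mono conjI)
      fix S e
      show "0 \<le> 1 / (th x e * (1 - th x e))"
        using th_pos[of x e] by simp
      have "1 / (th x e * (1 - th x e)) \<le> 1 / (q / 8)"
        using th_var[of x e] q by (intro divide_left_mono) auto
      then show "1 / (th x e * (1 - th x e)) \<le> 8 / q" by simp
      show "0 \<le> a S * a S" by simp
    qed
    also have "\<dots> = (\<Sum>T\<in>lowdeg. (8 * q * \<epsilon>\<^sup>2) ^ card T * (kap T)\<^sup>2)"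
    proof (rule sum.cong[OF refl])
      fix S :: "(nat \<times> nat) set"
      have "(q * \<epsilon>)\<^sup>2 * (8 / q) = 8 * q * \<epsilon>\<^sup>2"
        using q by (simp add: power2_eq_square)
      moreover have "((q * \<epsilon>) ^ card S)\<^sup>2 * (8 / q) ^ card S = ((q * \<epsilon>)\<^sup>2 * (8 / q)) ^ card S"
        unfolding power_mult_distrib[of "(q * \<epsilon>)\<^sup>2"] power_mult[symmetric] by (simp only: mult.commute)
      ultimately have "((q * \<epsilon>) ^ card S)\<^sup>2 * (8 / q) ^ card S = (8 * q * \<epsilon>\<^sup>2) ^ card S"
        by (simp only:)
      then show "a S * a S * (\<Prod>e\<in>S. 8 / q) = (8 * q * \<epsilon>\<^sup>2) ^ card S * (kap S)\<^sup>2"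
        unfolding a_def by (simp add: power2_eq_square mult_ac)
    qed
    finally show ?thesis .
  qed
  then have "EE (\<lambda>x E. (certificate x E)\<^sup>2)
      \<le> avg n k (\<lambda>_. \<Sum>T\<in>lowdeg. (8 * q * \<epsilon>\<^sup>2) ^ card T * (kap T)\<^sup>2)"
    unfolding ssbm_exp_def by (intro avg_mono)
  then show ?thesis by (simp add: avg_const k_pos)
qed

lemma EE_only_labels: "EE (\<lambda>x E. g x) = avg n k g"
  using EE_centred_dual[of "{}" "{}" g] by (simp add: centred_mono_def dual_mono_def cprod_empty)

text \<open>Let M be the indicator of uv, h the certificate and G the rescaled estimate of M.
  Orthogonality gives E[G h] = E[G M], hence \<open>E (G - M)\<^sup>2 = E (G - h)\<^sup>2 + E
  M\<^sup>2 - E h\<^sup>2\<close>, and the first square is dropped.\<close>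

lemma pair_risk_ge:
  assumes orth: "EE (\<lambda>x E. F E * (certificate x E - cent k x (u, v))) = 0"
  shows "(q * \<epsilon>)\<^sup>2 * ((1 - 1 / real k) / real k - (\<Sum>T\<in>lowdeg. (8 * q * \<epsilon>\<^sup>2) ^ card T * (kap T)\<^sup>2))
    \<le> EE (\<lambda>x E. (F E - ssbm_theta q \<epsilon> k x u v)\<^sup>2)"
proof -
  define M where "M = (\<lambda>x. cent k x (u, v))"
  define G where "G = (\<lambda>E. (F E - q) / (q * \<epsilon>))"
  have qe: "q * \<epsilon> \<noteq> 0" using q eps by simp
  \<comment> \<open>Constants are polynomials of degree 0, so shifting \<open>F\<close> by
    \<open>q\<close> preserves the orthogonality.\<close>
  have "EE (\<lambda>x E. of_bool ({} \<subseteq> E) * (certificate x E - cent k x (u, v))) = 0"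
    by (rule EE_mono_certificate) (simp add: lowdeg_def)
  then have "EE (\<lambda>x E. F E * (certificate x E - M x)) - q * EE (\<lambda>x E. certificate x E - M x) = 0"
    using orth by (simp add: M_def)
  then have "EE (\<lambda>x E. (1 / (q * \<epsilon>)) * (F E * (certificate x E - M x) - q * (certificate x E - M x))) = 0"
    unfolding ssbm_exp_cmult ssbm_exp_diff by simp
  moreover have "(\<lambda>x E. (1 / (q * \<epsilon>)) * (F E * (certificate x E - M x) - q * (certificate x E - M x)))
      = (\<lambda>x E. G E * (certificate x E - M x))"
    unfolding G_def by (intro ext) (simp add: left_diff_distrib diff_divide_distrib)
  ultimately have G: "EE (\<lambda>x E. G E * (certificate x E - M x)) = 0" by simp
  have "EE (\<lambda>x E. (G E - M x)\<^sup>2)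
      = EE (\<lambda>x E. ((G E - certificate x E)\<^sup>2 + 2 * (G E * (certificate x E - M x))) + ((M x)\<^sup>2 - (certificate x E)\<^sup>2))"
    by (intro arg_cong[where f = EE] ext) (simp add: power2_eq_square algebra_simps)
  also have "\<dots> = EE (\<lambda>x E. (G E - certificate x E)\<^sup>2) + EE (\<lambda>x E. (M x)\<^sup>2) - EE (\<lambda>x E. (certificate x E)\<^sup>2)"
    unfolding ssbm_exp_add ssbm_exp_diff ssbm_exp_cmult G by simp
  finally have "EE (\<lambda>x E. (M x)\<^sup>2) - EE (\<lambda>x E. (certificate x E)\<^sup>2) \<le> EE (\<lambda>x E. (G E - M x)\<^sup>2)"
    using EE_nonneg[of "\<lambda>x E. (G E - certificate x E)\<^sup>2"] by simp
  moreover have "EE (\<lambda>x E. (M x)\<^sup>2) = (1 - 1 / real k) / real k"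
    unfolding EE_only_labels M_def using avg_cent_sq u_neq_v u_less v_less k_pos by simp
  ultimately have "(1 - 1 / real k) / real k - (\<Sum>T\<in>lowdeg. (8 * q * \<epsilon>\<^sup>2) ^ card T * (kap T)\<^sup>2)
      \<le> EE (\<lambda>x E. (G E - M x)\<^sup>2)"
    using EE_certificate_sq by linarith
  then have "(q * \<epsilon>)\<^sup>2 * ((1 - 1 / real k) / real k - (\<Sum>T\<in>lowdeg. (8 * q * \<epsilon>\<^sup>2) ^ card T * (kap T)\<^sup>2))
      \<le> (q * \<epsilon>)\<^sup>2 * EE (\<lambda>x E. (G E - M x)\<^sup>2)"
    by (rule mult_left_mono) simp
  also have "\<dots> = EE (\<lambda>x E. (q * \<epsilon>)\<^sup>2 * (G E - M x)\<^sup>2)"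
    by (rule ssbm_exp_cmult[symmetric])
  also have "\<dots> = EE (\<lambda>x E. (F E - ssbm_theta q \<epsilon> k x u v)\<^sup>2)"
  proof (intro arg_cong[where f = EE] ext)
    fix x E
    have "F E - ssbm_theta q \<epsilon> k x u v = (q * \<epsilon>) * (G E - M x)"
      using qe by (simp add: ssbm_theta_eq[OF k_pos] G_def M_def field_simps)
    then show "(q * \<epsilon>)\<^sup>2 * (G E - M x)\<^sup>2 = (F E - ssbm_theta q \<epsilon> k x u v)\<^sup>2"
      by (simp add: power_mult_distrib)
  qed
  finally show ?thesis .
qed

end

section \<open>The risk lower bound\<close>

text \<open>On 0/1 entries positive powers collapse and (i, j), (j, i) name the same edge, so a
  monomial becomes the indicator that a set of at most \<open>l\<close> edges is present. A diagonal
  entry makes it vanish, hence the scalar \<open>b\<close>.\<close>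

lemma monomial_eval_adj:
  assumes \<alpha>: "\<alpha> \<in> deg_monos n l"
  shows "\<exists>Q b. Q \<subseteq> pairs n \<and> card Q \<le> l \<and>
    (\<forall>E. E \<subseteq> pairs n \<longrightarrow> monomial_eval n \<alpha> (adj E) = b * of_bool (Q \<subseteq> E))"
proof -
  define I where "I = {p. \<alpha> p \<noteq> 0}"
  have I: "I \<subseteq> {..<n} \<times> {..<n}" using \<alpha> by (auto simp: I_def deg_monos_def)
  then have finI: "finite I" by (rule finite_subset) simp
  have "card I \<le> (\<Sum>p\<in>I. \<alpha> p)"
    using sum_mono[of I "\<lambda>_. 1" \<alpha>] by (auto simp: I_def)
  also have "\<dots> \<le> (\<Sum>p\<in>{..<n} \<times> {..<n}. \<alpha> p)"
    using I by (intro sum_mono2) auto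
  also have "\<dots> \<le> l" using \<alpha> by (simp add: deg_monos_def)
  finally have cardI: "card I \<le> l" .
  have ev: "monomial_eval n \<alpha> (adj E) = of_bool (\<forall>p\<in>I. adj E (fst p) (snd p) = 1)" for E
  proof (cases "\<forall>p\<in>I. adj E (fst p) (snd p) = 1")
    case True
    then have "adj E (fst p) (snd p) ^ \<alpha> p = 1" for p
      by (cases "\<alpha> p = 0") (auto simp: I_def)
    then show ?thesis using True by (simp add: monomial_eval_def)
  next
    case False
    then obtain p where p: "p \<in> I" "adj E (fst p) (snd p) \<noteq> 1" by blast
    then have "adj E (fst p) (snd p) ^ \<alpha> p = 0"
      by (auto simp: I_def adj_def split: if_splits)
    then have "monomial_eval n \<alpha> (adj E) = 0"
      unfolding monomial_eval_def using p(1) I by (intro prod_zero bexI[of _ p]) auto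
    then show ?thesis using False by simp
  qed
  show ?thesis
  proof (cases "\<exists>i. (i, i) \<in> I")
    case True
    then obtain i where i: "(i, i) \<in> I" by blast
    have "monomial_eval n \<alpha> (adj E) = 0 * of_bool ({} \<subseteq> E)" if "E \<subseteq> pairs n" for E
    proof -
      have "adj E i i = 0" using that by (auto simp: adj_def pairs_def)
      then have "\<not> (\<forall>p\<in>I. adj E (fst p) (snd p) = 1)" using i by (intro notI) (drule bspec[OF _ i], simp)
      then show ?thesis using ev[of E] by simp
    qed
    then show ?thesis by (intro exI[of _ "{}"] exI[of _ 0]) auto
  next
    case False
    define Q where "Q = (\<lambda>p. edge (fst p) (snd p)) ` I"
    have Q: "Q \<subseteq> pairs n"
    proof
      fix e assume "e \<in> Q"
      then obtain i j where ij: "(i, j) \<in> I" "e = edge i j" by (auto simp: Q_def)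
      then have "i \<noteq> j" "i < n" "j < n" using False I by auto
      then show "e \<in> pairs n" using ij by (auto simp: pairs_def edge_def min_def max_def)
    qed
    have "card Q \<le> card I" unfolding Q_def using finI by (rule card_image_le)
    then have "card Q \<le> l" using cardI by simp
    moreover have "monomial_eval n \<alpha> (adj E) = 1 * of_bool (Q \<subseteq> E)" if E: "E \<subseteq> pairs n" for E
    proof -
      have "adj E i j = 1 \<longleftrightarrow> edge i j \<in> E" for i j
        using E by (auto simp: adj_def pairs_def edge_def min_def max_def)
      then have "(\<forall>p\<in>I. adj E (fst p) (snd p) = 1) \<longleftrightarrow> Q \<subseteq> E"
        by (auto simp: Q_def)
      then show ?thesis using ev by simp
    qed
    ultimately show ?thesis using Q by blast
  qed
qed

lemma sym_mat_adj: "sym_mat n (adj E)"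
  by (auto simp: sym_mat_def adj_def)

lemma (in ssbm_model) EE_poly_certificate:
  assumes "f \<in> poly_maps n l"
  shows "EE (\<lambda>x E. f (adj E) u v * (certificate x E - cent k x (u, v))) = 0"
proof -
  have "\<exists>c. \<forall>Y. sym_mat n Y \<longrightarrow> f Y u v = (\<Sum>\<alpha>\<in>deg_monos n l. c \<alpha> * monomial_eval n \<alpha> Y)"
    using assms u_less v_less by (simp add: poly_maps_def)
  then obtain c where c: "\<And>Y. sym_mat n Y \<Longrightarrow> f Y u v = (\<Sum>\<alpha>\<in>deg_monos n l. c \<alpha> * monomial_eval n \<alpha> Y)"
    by (elim exE) simp
  have "EE (\<lambda>x E. f (adj E) u v * (certificate x E - cent k x (u, v)))
      = EE (\<lambda>x E. \<Sum>\<alpha>\<in>deg_monos n l. c \<alpha> * (monomial_eval n \<alpha> (adj E) * (certificate x E - cent k x (u, v))))"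
    by (simp add: c[OF sym_mat_adj] sum_distrib_right mult.assoc)
  also have "\<dots> = (\<Sum>\<alpha>\<in>deg_monos n l. c \<alpha> * EE (\<lambda>x E. monomial_eval n \<alpha> (adj E) * (certificate x E - cent k x (u, v))))"
    unfolding ssbm_exp_sum ssbm_exp_cmult ..
  also have "\<dots> = 0"
  proof (intro sum.neutral ballI)
    fix \<alpha> assume "\<alpha> \<in> deg_monos n l"
    from monomial_eval_adj[OF this] obtain Q b where Q: "Q \<subseteq> pairs n" "card Q \<le> l"
      and ev: "\<forall>E. E \<subseteq> pairs n \<longrightarrow> monomial_eval n \<alpha> (adj E) = b * of_bool (Q \<subseteq> E)"
      by (elim exE conjE)
    have "EE (\<lambda>x E. monomial_eval n \<alpha> (adj E) * (certificate x E - cent k x (u, v)))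
        = EE (\<lambda>x E. b * (of_bool (Q \<subseteq> E) * (certificate x E - cent k x (u, v))))"
      by (rule ssbm_exp_cong) (simp add: ev)
    also have "\<dots> = 0"
      unfolding ssbm_exp_cmult using EE_mono_certificate[of Q] Q by (simp add: lowdeg_def)
    finally show "c \<alpha> * EE (\<lambda>x E. monomial_eval n \<alpha> (adj E) * (certificate x E - cent k x (u, v))) = 0"
      by simp
  qed
  finally show ?thesis .
qed

text \<open>Each of the \<open>n * (n - 1)\<close> off-diagonal entries contributes at least
  \<open>(q * \<epsilon>)\<^sup>2 / (4 * real k)\<close>: the variance is at least
  1/(2\<open>k\<close>) and the certificate has square norm at most
  \<open>32 * \<rho> / (real k)\<^sup>2\<close>, which is at most 1/(4\<open>k\<close>). Diagonal
  entries are bounded below by 0.\<close>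

lemma ssbm_risk_ge:
  fixes q \<epsilon> \<rho> :: real
  assumes k: "2 \<le> k" and q: "0 < q" "q \<le> 1 / 2" and eps: "0 < \<epsilon>" "\<epsilon> \<le> 1 / 2"
    and f: "f \<in> poly_maps n l"
    and L: "128 * real n * q * \<epsilon>\<^sup>2 \<le> (real k)\<^sup>2"
    and \<rho>: "\<rho> = 2 * (real l + 2)\<^sup>2 * (8 * q * \<epsilon>\<^sup>2) * (4 * real l + 4) ^ 12" "\<rho> \<le> 1 / 256"
  shows "ssbm_risk n q \<epsilon> k f \<ge> real n * (real n - 1) * ((q * \<epsilon>)\<^sup>2 / (4 * real k))"
proof -
  define r where "r = (\<lambda>i j. ssbm_exp n q \<epsilon> k (\<lambda>x E. (f (adj E) i j - ssbm_theta q \<epsilon> k x i j)\<^sup>2))"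
  have r: "(if i = j then 0 else (q * \<epsilon>)\<^sup>2 / (4 * real k)) \<le> r i j" if "i < n" "j < n" for i j
  proof (cases "i = j")
    case False
    interpret ssbm_model n k i j q \<epsilon> l
      by unfold_locales (use k q eps that False in auto)
    have "(\<Sum>T\<in>lowdeg. (8 * q * \<epsilon>\<^sup>2) ^ card T * (kap T)\<^sup>2) \<le> 32 * \<rho> / (real k)\<^sup>2"
    proof -
      have "16 * real n * (8 * q * \<epsilon>\<^sup>2) = 128 * real n * q * \<epsilon>\<^sup>2" by simp
      then have "16 * real n * (8 * q * \<epsilon>\<^sup>2) \<le> (real k)\<^sup>2" using L by linarith
      moreover have "0 \<le> 8 * q * \<epsilon>\<^sup>2" "\<rho> \<le> 1 / 2" using q \<rho>(2) by auto
      ultimately show ?thesis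
        unfolding lowdeg_def using \<rho>(1) by (intro sum_kap_sq_le)
    qed
    also have "\<dots> \<le> 32 * (1 / 256) / (real k)\<^sup>2"
      using \<rho>(2) by (intro divide_right_mono mult_left_mono) auto
    also have "\<dots> \<le> 1 / (4 * real k)"
      using k by (simp add: power2_eq_square field_simps)
    finally have "(\<Sum>T\<in>lowdeg. (8 * q * \<epsilon>\<^sup>2) ^ card T * (kap T)\<^sup>2) \<le> 1 / (4 * real k)" .
    moreover have "1 / (2 * real k) \<le> (1 - 1 / real k) / real k"
      using k by (simp add: field_simps)
    moreover have "1 / (2 * real k) - 1 / (4 * real k) = 1 / (4 * real k)"
      using k by (simp add: field_simps)
    ultimately have "1 / (4 * real k) \<le> (1 - 1 / real k) / real k - (\<Sum>T\<in>lowdeg. (8 * q * \<epsilon>\<^sup>2) ^ card T * (kap T)\<^sup>2)"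
      by linarith
    then have "(q * \<epsilon>)\<^sup>2 * (1 / (4 * real k))
        \<le> (q * \<epsilon>)\<^sup>2 * ((1 - 1 / real k) / real k - (\<Sum>T\<in>lowdeg. (8 * q * \<epsilon>\<^sup>2) ^ card T * (kap T)\<^sup>2))"
      by (rule mult_left_mono) simp
    also have "\<dots> \<le> r i j"
      unfolding r_def by (rule pair_risk_ge[OF EE_poly_certificate[OF f]])
    finally show ?thesis using False by simp
  next
    case True
    have "r i j \<ge> 0"
      unfolding r_def ssbm_exp_def avg_def graph_prob_def
    proof (intro divide_nonneg_nonneg sum_nonneg mult_nonneg_nonneg prod_nonneg)
      fix x E e
      have "\<bar>cent k x e\<bar> \<le> 1" using abs_cent_le k by simp
      then have "\<bar>q * \<epsilon> * cent k x e\<bar> \<le> q * (1 / 2) * 1"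
        unfolding abs_mult using q eps by (intro mult_mono) auto
      then have "0 \<le> ssbm_theta q \<epsilon> k x (fst e) (snd e) \<and> ssbm_theta q \<epsilon> k x (fst e) (snd e) \<le> 1"
        using k q by (simp add: ssbm_theta_eq) linarith
      then show "0 \<le> (if e \<in> E then ssbm_theta q \<epsilon> k x (fst e) (snd e)
          else 1 - ssbm_theta q \<epsilon> k x (fst e) (snd e))" by simp
    qed auto
    then show ?thesis using True by simp
  qed
  have "(\<Sum>j<n. if i = j then 0 else (q * \<epsilon>)\<^sup>2 / (4 * real k)) = (real n - 1) * ((q * \<epsilon>)\<^sup>2 / (4 * real k))"
    if "i < n" for i
  proof -
    have "(\<Sum>j<n. if i = j then 0 else (q * \<epsilon>)\<^sup>2 / (4 * real k))
        = (\<Sum>j<n. (q * \<epsilon>)\<^sup>2 / (4 * real k) - (if i = j then (q * \<epsilon>)\<^sup>2 / (4 * real k) else 0))"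
      by (intro sum.cong) auto
    also have "\<dots> = (real n - 1) * ((q * \<epsilon>)\<^sup>2 / (4 * real k))"
      using that by (simp add: sum_subtractf left_diff_distrib diff_divide_distrib)
    finally show ?thesis .
  qed
  then have "real n * (real n - 1) * ((q * \<epsilon>)\<^sup>2 / (4 * real k))
      = (\<Sum>i<n. \<Sum>j<n. if i = j then 0 else (q * \<epsilon>)\<^sup>2 / (4 * real k))"
    by simp
  also have "\<dots> \<le> (\<Sum>i<n. \<Sum>j<n. r i j)"
    using r by (intro sum_mono) auto
  finally show ?thesis by (simp add: ssbm_risk_eq r_def)
qed

theorem theoremE1:
  fixes c :: real
  assumes "0 < c" and "c \<le> 1/2"
  shows "\<exists>C>0. \<exists>N. \<forall>n\<ge>N. \<forall>k l :: nat.
           n > 0 \<and> 2 \<le> k \<and> real k \<le> real n powr 0.001 \<and> real l \<le> real n powr 0.001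
           \<and> k dvd n \<longrightarrow>
           (\<forall>f\<in>poly_maps n l. \<exists>\<epsilon>\<in>{0..1}.
              ssbm_risk n ((c * real n) / real n) \<epsilon> k f \<ge> C * real k * real n)"
proof -
  \<comment> \<open>This dominates \<open>\<rho>\<close> once \<open>k\<close> and \<open>l\<close>
    are replaced by their common bound; it has order n to the power 0.016 - 1.\<close>
  have "\<forall>\<^sub>F n :: nat in sequentially. (real n powr 0.001 + 2)\<^sup>2 * (real n powr 0.001)\<^sup>2
      * (4 * real n powr 0.001 + 4) ^ 12 / (8 * real n) \<le> 1 / 256"
    by real_asymp
  \<comment> \<open>This will give \<open>\<epsilon> \<le> 1 / 2\<close>.\<close>
  moreover have "\<forall>\<^sub>F n :: nat in sequentially. (real n powr 0.001)\<^sup>2 \<le> 32 * c * real n"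
    using assms by real_asymp
  ultimately have "\<forall>\<^sub>F n :: nat in sequentially. (real n powr 0.001 + 2)\<^sup>2 * (real n powr 0.001)\<^sup>2
      * (4 * real n powr 0.001 + 4) ^ 12 / (8 * real n) \<le> 1 / 256
      \<and> (real n powr 0.001)\<^sup>2 \<le> 32 * c * real n \<and> n \<ge> 2"
    using eventually_ge_at_top[of "2 :: nat"] by eventually_elim simp
  then obtain N where N: "\<And>n. n \<ge> N \<Longrightarrow> (real n powr 0.001 + 2)\<^sup>2 * (real n powr 0.001)\<^sup>2
      * (4 * real n powr 0.001 + 4) ^ 12 / (8 * real n) \<le> 1 / 256
      \<and> (real n powr 0.001)\<^sup>2 \<le> 32 * c * real n \<and> n \<ge> 2"
    unfolding eventually_sequentially by blast
  have main: "\<exists>\<epsilon>\<in>{0..1}. ssbm_risk n ((c * real n) / real n) \<epsilon> k f \<ge> c / 1024 * real k * real n"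
    if n: "n \<ge> N" and k: "2 \<le> k" "real k \<le> real n powr 0.001" and l: "real l \<le> real n powr 0.001"
      and f: "f \<in> poly_maps n l" for n k l f
  proof -
    define t where "t = real n powr 0.001"
    have n2: "n \<ge> 2" and tb: "(t + 2)\<^sup>2 * t\<^sup>2 * (4 * t + 4) ^ 12 / (8 * real n) \<le> 1 / 256"
      "t\<^sup>2 \<le> 32 * c * real n"
      using N[OF n] by (auto simp: t_def)
    \<comment> \<open>The largest value allowed by the condition on \<open>L\<close> in
      \<open>ssbm_risk_ge\<close>, which then holds with equality.\<close>
    define \<epsilon> where "\<epsilon> = real k / sqrt (128 * c * real n)"
    have cn: "128 * c * real n > 0" using assms n2 by simp
    have eps2: "\<epsilon>\<^sup>2 = (real k)\<^sup>2 / (128 * c * real n)"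
      using cn by (simp add: \<epsilon>_def power_divide)
    have eps0: "0 < \<epsilon>" using k cn by (simp add: \<epsilon>_def)
    have kt: "(real k)\<^sup>2 \<le> t\<^sup>2" using k by (intro power_mono) (auto simp: t_def)
    have "\<epsilon>\<^sup>2 \<le> (1 / 2)\<^sup>2"
      unfolding eps2 using kt tb(2) cn by (simp add: power2_eq_square divide_simps)
    then have eps1: "\<epsilon> \<le> 1 / 2"
      by (rule power2_le_imp_le) simp
    have L: "8 * c * \<epsilon>\<^sup>2 = (real k)\<^sup>2 / (16 * real n)"
      unfolding eps2 using assms n2 by (simp add: field_simps)
    have "2 * (real l + 2)\<^sup>2 * (8 * c * \<epsilon>\<^sup>2) * (4 * real l + 4) ^ 12
        = (real l + 2)\<^sup>2 * (real k)\<^sup>2 * (4 * real l + 4) ^ 12 / (8 * real n)"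
      unfolding L using n2 by (simp add: field_simps)
    also have "\<dots> \<le> (t + 2)\<^sup>2 * t\<^sup>2 * (4 * t + 4) ^ 12 / (8 * real n)"
      using l by (intro divide_right_mono mult_mono kt power_mono) (auto simp: t_def)
    also have "\<dots> \<le> 1 / 256" by (rule tb(1))
    finally have \<rho>: "2 * (real l + 2)\<^sup>2 * (8 * c * \<epsilon>\<^sup>2) * (4 * real l + 4) ^ 12 \<le> 1 / 256" .
    have "128 * real n * c * \<epsilon>\<^sup>2 \<le> (real k)\<^sup>2"
      unfolding eps2 using assms n2 by simp
    from ssbm_risk_ge[OF k(1) assms eps0 eps1 f this refl \<rho>]
    have risk: "real n * (real n - 1) * ((c * \<epsilon>)\<^sup>2 / (4 * real k)) \<le> ssbm_risk n c \<epsilon> k f" .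
    \<comment> \<open>The 512 is 128 * 4; replacing \<open>n - 1\<close> by \<open>n / 2\<close>
      below turns it into 1024.\<close>
    have "real n * (real n - 1) * ((c * \<epsilon>)\<^sup>2 / (4 * real k)) = c / 512 * real k * (real n - 1)"
      unfolding power_mult_distrib eps2 using assms n2 k by (simp add: power2_eq_square field_simps)
    moreover have "c / 512 * real k * (real n - 1) \<ge> c / 512 * real k * (real n / 2)"
      using assms n2 by (intro mult_left_mono) auto
    moreover have "c / 512 * real k * (real n / 2) = c / 1024 * real k * real n" by simp
    ultimately have "c / 1024 * real k * real n \<le> ssbm_risk n c \<epsilon> k f"
      using risk by linarith
    moreover have "c * real n / real n = c" using n2 by simp
    ultimately show ?thesis
      using eps0 eps1 by (intro bexI[of _ \<epsilon>]) auto
  qed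
  show ?thesis
  proof (intro exI conjI)
    show "0 < c / 1024" using assms by simp
    show "\<forall>n\<ge>N. \<forall>k l :: nat.
           n > 0 \<and> 2 \<le> k \<and> real k \<le> real n powr 0.001 \<and> real l \<le> real n powr 0.001
           \<and> k dvd n \<longrightarrow>
           (\<forall>f\<in>poly_maps n l. \<exists>\<epsilon>\<in>{0..1}.
              ssbm_risk n ((c * real n) / real n) \<epsilon> k f \<ge> c / 1024 * real k * real n)"
      by (intro allI impI ballI, elim conjE, rule main)
  qed
qed

end
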